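(* Let $\mathbf X\sim TN_p(\mathbf 0,\mathbf R;[\mathbf a,\mathbf b])$, with $\mathbf R=[\rho_{ij}]$ being a correlation matrix of order $p\times p$, and let $m(\mathbf t)$ be the moment generating function of $\mathbf X$. Then the first two moments of $\mathbf X$ are given by $$\mathbb E[\mathbf X]=\left.\frac{\partial m(\mathbf t)}{\partial\mathbf t}\right|_{\mathbf t=\mathbf 0}^{\top}=-\frac1L\mathbf R\mathbf q,\qquad \mathbb E[\mathbf X\mathbf X^\top]=\left.\frac{\partial^2m(\mathbf t)}{\partial\mathbf t\,\partial\mathbf t^\top}\right|_{\mathbf t=\mathbf 0}=\mathbf R+\frac1L\mathbf R\mathbf H\mathbf R,$$ and consequently $$\mathrm{cov}[\mathbf X]=\mathbf R+\frac1{L^2}\mathbf R\big(L\mathbf H-\mathbf q\mathbf q^\top\big)\mathbf R.$$ Here $L\equiv L_p(\mathbf a,\mathbf b;\mathbf 0,\mathbf R)$, $\mathbf q=\mathbf q_a-\mathbf q_b$, with the $i$-th elements of $\mathbf q_a$ and $\mathbf q_b$ being $$q_{a,i}=\phi_1(a_i)\,L_{p-1}(\mathbf a_{(i)},\mathbf b_{(i)};a_i\mathbf R_{(i),i},\tilde{\mathbf R}_i),\qquad q_{b,i}=\phi_1(b_i)\,L_{p-1}(\mathbf a_{(i)},\mathbf b_{(i)};b_i\mathbf R_{(i),i},\tilde{\mathbf R}_i),$$ and $\mathbf H$ is a symmetric matrix of dimension $p$, with off-diagonal elements $h_{ij}$ given by $$\begin{aligned}h_{ij}={}&h_{ij}^{aa}-h_{ij}^{ba}-h_{ij}^{ab}+h_{ij}^{bb}\\={}&\phi_2(a_i,a_j;\rho_{ij})\,L_{p-2}(\mathbf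 a_{(i,j)},\mathbf b_{(i,j)};\boldsymbol\mu_{ij}^{aa},\tilde{\mathbf R}_{ij})-\phi_2(b_i,a_j;\rho_{ij})\,L_{p-2}(\mathbf a_{(i,j)},\mathbf b_{(i,j)};\boldsymbol\mu_{ij}^{ba},\tilde{\mathbf R}_{ij})\\&-\phi_2(a_i,b_j;\rho_{ij})\,L_{p-2}(\mathbf a_{(i,j)},\mathbf b_{(i,j)};\boldsymbol\mu_{ij}^{ab},\tilde{\mathbf R}_{ij})+\phi_2(b_i,b_j;\rho_{ij})\,L_{p-2}(\mathbf a_{(i,j)},\mathbf b_{(i,j)};\boldsymbol\mu_{ij}^{bb},\tilde{\mathbf R}_{ij}),\end{aligned}$$ (the four $h_{ij}^{\alpha\beta}$ being the four products, in the order written) and diagonal elements $$h_{ii}=a_iq_{a,i}-b_iq_{b,i}-\mathbf R_{i,(i)}\mathbf H_{(i),i},$$ with $\tilde{\mathbf R}_i=\mathbf R_{(i),(i)}-\mathbf R_{(i),i}\mathbf R_{i,(i)}$, $\boldsymbol\mu_{ij}^{\alpha\beta}=\mathbf R_{(i,j),[i,j]}(\alpha_i,\beta_j)^\top$ for $\alpha,\beta\in\{a,b\}$, and $\tilde{\mathbf R}_{ij}=\mathbf R_{(i,j),(i,j)}-\mathbf R_{(i,j),[i,j]}\mathbf R_{[i,j],(i,j)}$.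
   Context: $TN_p(\boldsymbol\mu,\boldsymbol\Sigma;[\mathbf a,\mathbf b])$ denotes the $p$-variate truncated normal distribution on $[\mathbf a,\mathbf b]$, i.e. the distribution of a $N_p(\boldsymbol\mu,\boldsymbol\Sigma)$ vector conditioned to lie in the box $\{\mathbf x\in\mathbb R^p:\mathbf a\le\mathbf x\le\mathbf b\}$ (inequalities componentwise), where $\mathbf a=(a_1,\ldots,a_p)^\top$ and $\mathbf b=(b_1,\ldots,b_p)^\top$. $L_p(\mathbf a,\mathbf b;\boldsymbol\mu,\boldsymbol\Sigma)=\int_{\mathbf a}^{\mathbf b}\phi_p(\mathbf x;\boldsymbol\mu,\boldsymbol\Sigma)\,d\mathbf x$, where $\phi_p(\cdot;\boldsymbol\mu,\boldsymbol\Sigma)$ is the $p$-variate normal density with mean vector $\boldsymbol\mu$ and variance-covariance matrix $\boldsymbol\Sigma$. $\phi_1(\cdot)$ is the standard univariate normal density and $\phi_2(\cdot,\cdot;\rho)$ is the bivariate normal density with zero means, unit variances and correlation $\rho$. The moment generating function is $m(\mathbf t)=\mathbb E[e^{\mathbf t^\top\mathbf X}]$. Index notation: for a vector, the subscript $(i)$ means that its $i$th element is removed, and $(i,j)$ that its $i$th and $j$th elements are removed. For a matrix, the two subscript slots refer to rows and columns respectively: $i$ in a slot selects the $i$th row/column, $(i)$ removes the $i$th row/column, $(i,j)$ removes the $i$th and $j$th rows/columns, and $[i,j]$ keeps only the $i$th and $j$th rows/columns. Thus $\mathbf R_{(i),i}$ is the $i$th column of $\mathbf R$ with its $i$th element removed,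 $\mathbf R_{i,(i)}$ is the $i$th row of $\mathbf R$ with its $i$th element removed, $\mathbf R_{(i),(i)}$ is $\mathbf R$ with its $i$th row and column removed, and $\mathbf H_{(i),i}$ is the $i$th column of $\mathbf H$ with its $i$th element removed.
   Formalization: The mean is proved as E[X] = +(1/L)Rq (printed sign is wrong), and μ_ij and R̃_ij carry the missing factor R_{[i,j],[i,j]}^{-1} after R_{(i,j),[i,j]}; R is assumed invertible and a_i < b_i for all i, so that the density and the conditioning are defined. *)

theory Defs
  imports "HOL-Probability.Probability"
begin

section \<open>Sub-blocks of vectors and matrices\<close>

text \<open>
  Vectors of length \<open>p\<close> are elements of \<open>real ^ 'n\<close> with \<open>p = CARD('n)\<close>. Removing or keeping
  coordinates is not a change of type: a sub-vector or sub-matrix is given by the set of the index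
  values that are kept, and is stored with zeros elsewhere. The slots \<open>i\<close>, \<open>(i)\<close>, \<open>(i,j)\<close>,
  \<open>[i,j]\<close> are the index sets \<open>{i}\<close>, \<open>- {i}\<close>, \<open>- {i, j}\<close>, \<open>{i, j}\<close>. Products of the zero-padded
  blocks are the zero-padded products of the blocks.
\<close>

definition block :: "'n set \<Rightarrow> 'n set \<Rightarrow> real ^ 'n ^ 'n \<Rightarrow> real ^ 'n ^ 'n" where
  "block I J A = (\<chi> i j. if i \<in> I \<and> j \<in> J then A $ i $ j else 0)"

text \<open>
  Determinant and inverse of the principal sub-matrix with index set \<open>J\<close>, computed by completing it
  with the identity matrix on the other indices. See \<open>det_on_leibniz\<close>, \<open>inv_on_right\<close> and
  \<open>inv_on_left\<close> below.
\<close>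

definition completed :: "'n set \<Rightarrow> real ^ 'n ^ 'n \<Rightarrow> real ^ 'n ^ 'n" where
  "completed J A = block J J A + block (- J) (- J) (mat 1)"

definition det_on :: "'n::finite set \<Rightarrow> real ^ 'n ^ 'n \<Rightarrow> real" where
  "det_on J A = det (completed J A)"

definition inv_on :: "'n::finite set \<Rightarrow> real ^ 'n ^ 'n \<Rightarrow> real ^ 'n ^ 'n" where
  "inv_on J A = block J J (matrix_inv (completed J A))"

lemma completed_nth:
  "completed J A $ i $ j =
     (if i \<in> J \<and> j \<in> J then A $ i $ j else if i = j then 1 else 0)"
  by (auto simp: completed_def block_def mat_def)

lemma completed_UNIV [simp]: "completed UNIV A = A"
  by (simp add: vec_eq_iff completed_nth)

lemma det_on_UNIV: "det_on UNIV A = det A"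
  by (simp add: det_on_def)

lemma inv_on_UNIV: "inv_on UNIV A = matrix_inv A"
  by (simp add: inv_on_def block_def vec_eq_iff)

lemma det_on_leibniz:
  fixes A :: "real ^ 'n::finite ^ 'n"
  shows "det_on J A = (\<Sum>\<pi> | \<pi> permutes J. of_int (sign \<pi>) * (\<Prod>i\<in>J. A $ i $ \<pi> i))"
proof -
  let ?f = "\<lambda>\<pi>. of_int (sign \<pi>) * (\<Prod>i\<in>UNIV. completed J A $ i $ \<pi> i)"
  have sub: "{\<pi>. \<pi> permutes J} \<subseteq> {\<pi>. \<pi> permutes (UNIV :: 'n set)}"
    using permutes_subset by blast
  have zero: "?f \<pi> = 0" if "\<pi> permutes (UNIV :: 'n set)" "\<not> \<pi> permutes J" for \<pi>
  proof -
    from that have "\<exists>i. i \<notin> J \<and> \<pi> i \<noteq> i"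
      by (metis permutes_superset DiffD2)
    then obtain i where i: "i \<notin> J" "\<pi> i \<noteq> i" by blast
    then have "completed J A $ i $ \<pi> i = 0"
      by (auto simp: completed_nth)
    then have "(\<Prod>i\<in>UNIV. completed J A $ i $ \<pi> i) = 0"
      by (intro prod_zero) auto
    then show ?thesis by simp
  qed
  have eq: "?f \<pi> = of_int (sign \<pi>) * (\<Prod>i\<in>J. A $ i $ \<pi> i)" if p: "\<pi> permutes J" for \<pi>
  proof -
    have "(\<Prod>i\<in>UNIV. completed J A $ i $ \<pi> i) = (\<Prod>i\<in>J. completed J A $ i $ \<pi> i)"
      by (rule prod.mono_neutral_right)
        (use p in \<open>auto simp: completed_nth permutes_not_in\<close>)
    also have "\<dots> = (\<Prod>i\<in>J. A $ i $ \<pi> i)"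
      by (rule prod.cong) (use p in \<open>auto simp: completed_nth permutes_in_image\<close>)
    finally show ?thesis by simp
  qed
  have "det_on J A = (\<Sum>\<pi> | \<pi> permutes (UNIV :: 'n set). ?f \<pi>)"
    by (simp add: det_on_def det_def)
  also have "\<dots> = (\<Sum>\<pi> | \<pi> permutes J. ?f \<pi>)"
    by (rule sum.mono_neutral_right) (use sub zero in \<open>auto simp: finite_permutations\<close>)
  also have "\<dots> = (\<Sum>\<pi> | \<pi> permutes J. of_int (sign \<pi>) * (\<Prod>i\<in>J. A $ i $ \<pi> i))"
    by (rule sum.cong) (use eq in auto)
  finally show ?thesis .
qed

lemma inv_on_right:
  fixes A :: "real ^ 'n::finite ^ 'n"
  assumes "det_on J A \<noteq> 0"
  shows "block J J A ** inv_on J A = block J J (mat 1)"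
proof -
  let ?C = "completed J A" and ?B = "matrix_inv (completed J A)"
  have "invertible ?C"
    using assms by (simp add: det_on_def invertible_det_nz)
  then have CB: "?C ** ?B = mat 1"
    unfolding invertible_def matrix_inv_def by (rule someI2_ex) blast
  have "(\<Sum>k\<in>UNIV. block J J A $ i $ k * inv_on J A $ k $ j) = (mat 1 :: real^'n^'n) $ i $ j"
    if "i \<in> J" "j \<in> J" for i j
  proof -
    have "(\<Sum>k\<in>UNIV. block J J A $ i $ k * inv_on J A $ k $ j) =
          (\<Sum>k\<in>UNIV. ?C $ i $ k * ?B $ k $ j)"
      by (rule sum.cong) (use that in \<open>auto simp: block_def inv_on_def completed_nth\<close>)
    also have "\<dots> = (?C ** ?B) $ i $ j"
      by (simp add: matrix_matrix_mult_def)
    finally show ?thesis using CB by simp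
  qed
  then show ?thesis
    by (auto simp: vec_eq_iff matrix_matrix_mult_def block_def inv_on_def)
qed

lemma inv_on_left:
  fixes A :: "real ^ 'n::finite ^ 'n"
  assumes "det_on J A \<noteq> 0"
  shows "inv_on J A ** block J J A = block J J (mat 1)"
proof -
  let ?C = "completed J A" and ?B = "matrix_inv (completed J A)"
  have "invertible ?C"
    using assms by (simp add: det_on_def invertible_det_nz)
  then have BC: "?B ** ?C = mat 1"
    unfolding invertible_def matrix_inv_def by (rule someI2_ex) blast
  have "(\<Sum>k\<in>UNIV. inv_on J A $ i $ k * block J J A $ k $ j) = (mat 1 :: real^'n^'n) $ i $ j"
    if "i \<in> J" "j \<in> J" for i j
  proof -
    have "(\<Sum>k\<in>UNIV. inv_on J A $ i $ k * block J J A $ k $ j) =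
          (\<Sum>k\<in>UNIV. ?B $ i $ k * ?C $ k $ j)"
      by (rule sum.cong) (use that in \<open>auto simp: block_def inv_on_def completed_nth\<close>)
    also have "\<dots> = (?B ** ?C) $ i $ j"
      by (simp add: matrix_matrix_mult_def)
    finally show ?thesis using BC by simp
  qed
  then show ?thesis
    by (auto simp: vec_eq_iff matrix_matrix_mult_def block_def inv_on_def)
qed


section \<open>Normal densities, box probabilities and the truncated normal law\<close>

text \<open>
  The multivariate normal density in the coordinates \<open>J\<close>; entries of \<open>\<mu>\<close>, \<open>\<Sigma>\<close>, \<open>x\<close> with an index
  outside \<open>J\<close> are not used. For \<open>J = UNIV\<close> it is the \<open>p\<close>-variate density.
\<close>

definition mvn_density ::
  "'n::finite set \<Rightarrow> real ^ 'n \<Rightarrow> real ^ 'n ^ 'n \<Rightarrow> real ^ 'n \<Rightarrow> real" where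
  "mvn_density J \<mu> \<Sigma> x =
     exp (- ((x - \<mu>) \<bullet> (inv_on J \<Sigma> *v (x - \<mu>))) / 2) / sqrt ((2 * pi) ^ card J * det_on J \<Sigma>)"

definition bvn_density :: "real \<Rightarrow> real \<Rightarrow> real \<Rightarrow> real" where
  "bvn_density x y \<rho> =
     exp (- (x\<^sup>2 - 2 * \<rho> * x * y + y\<^sup>2) / (2 * (1 - \<rho>\<^sup>2))) / (2 * pi * sqrt (1 - \<rho>\<^sup>2))"

text \<open>
  \<open>mvn_box J a b \<mu> \<Sigma>\<close> is the \<open>card J\<close>-dimensional integral \<open>L\<close> over the sub-box with coordinates
  \<open>J\<close>. For \<open>J = {}\<close> it is \<open>1\<close>, the convention \<open>L\<^sub>0 = 1\<close>.
\<close>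

definition mvn_box ::
  "'n::finite set \<Rightarrow> real ^ 'n \<Rightarrow> real ^ 'n \<Rightarrow> real ^ 'n \<Rightarrow> real ^ 'n ^ 'n \<Rightarrow> real" where
  "mvn_box J a b \<mu> \<Sigma> =
     (LINT x : (\<Pi>\<^sub>E k\<in>J. {a $ k .. b $ k}) | (\<Pi>\<^sub>M k\<in>J. lborel). mvn_density J \<mu> \<Sigma> (\<chi> k. x k))"

lemma mvn_box_empty: "mvn_box {} a b \<mu> \<Sigma> = 1"
proof -
  have "inv_on {} \<Sigma> = 0"
    by (simp add: inv_on_def block_def vec_eq_iff)
  moreover have "det_on {} \<Sigma> = 1"
    by (simp add: det_on_leibniz)
  ultimately show ?thesis
    by (simp add: mvn_box_def mvn_density_def set_lebesgue_integral_def PiM_empty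
        lebesgue_integral_count_space_finite)
qed

definition mvn :: "real ^ 'n \<Rightarrow> real ^ 'n ^ 'n \<Rightarrow> (real ^ 'n::finite) measure" where
  "mvn \<mu> \<Sigma> = density lborel (\<lambda>x. ennreal (mvn_density UNIV \<mu> \<Sigma> x))"

definition truncated_mvn ::
  "real ^ 'n \<Rightarrow> real ^ 'n ^ 'n \<Rightarrow> real ^ 'n \<Rightarrow> real ^ 'n \<Rightarrow> (real ^ 'n::finite) measure" where
  "truncated_mvn \<mu> \<Sigma> a b = uniform_measure (mvn \<mu> \<Sigma>) {x. \<forall>k. a $ k \<le> x $ k \<and> x $ k \<le> b $ k}"

definition correlation_matrix :: "real ^ 'n::finite ^ 'n \<Rightarrow> bool" where
  "correlation_matrix R \<longleftrightarrow>
     transpose R = R \<and> (\<forall>x. 0 \<le> x \<bullet> (R *v x)) \<and> (\<forall>i. R $ i $ i = 1)"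


section \<open>Moments and derivatives\<close>

definition outer :: "real ^ 'n \<Rightarrow> real ^ 'n \<Rightarrow> real ^ 'n::finite ^ 'n" where
  "outer x y = (columnvector x :: real ^ 1 ^ 'n) ** (rowvector y :: real ^ 'n ^ 1)"

definition mgf :: "'w measure \<Rightarrow> ('w \<Rightarrow> real ^ 'n::finite) \<Rightarrow> real ^ 'n \<Rightarrow> real" where
  "mgf M X t = (\<integral>\<omega>. exp (t \<bullet> X \<omega>) \<partial>M)"

definition mean_vec :: "'w measure \<Rightarrow> ('w \<Rightarrow> real ^ 'n::finite) \<Rightarrow> real ^ 'n" where
  "mean_vec M X = (\<integral>\<omega>. X \<omega> \<partial>M)"

definition second_moment :: "'w measure \<Rightarrow> ('w \<Rightarrow> real ^ 'n::finite) \<Rightarrow> real ^ 'n ^ 'n" where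
  "second_moment M X = (\<integral>\<omega>. outer (X \<omega>) (X \<omega>) \<partial>M)"

definition cov_mat :: "'w measure \<Rightarrow> ('w \<Rightarrow> real ^ 'n::finite) \<Rightarrow> real ^ 'n ^ 'n" where
  "cov_mat M X = (\<integral>\<omega>. outer (X \<omega> - mean_vec M X) (X \<omega> - mean_vec M X) \<partial>M)"

definition has_hessian :: "(real ^ 'n::finite \<Rightarrow> real) \<Rightarrow> real ^ 'n ^ 'n \<Rightarrow> real ^ 'n \<Rightarrow> bool" where
  "has_hessian f A t \<longleftrightarrow>
     (\<exists>G. (\<forall>\<^sub>F s in nhds t. GDERIV f s :> G s) \<and> (G has_derivative (\<lambda>h. A *v h)) (at t))"


section \<open>The vector \<open>q\<close> and the matrix \<open>H\<close>\<close>

definition R_tilde1 :: "real ^ 'n::finite ^ 'n \<Rightarrow> 'n \<Rightarrow> real ^ 'n ^ 'n" where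
  "R_tilde1 R i = block (- {i}) (- {i}) R - block (- {i}) {i} R ** block {i} (- {i}) R"

text \<open>
  The value at \<open>c = a\<^sub>i\<close> (resp. \<open>c = b\<^sub>i\<close>) is \<open>q\<^sub>a\<^sub>,\<^sub>i\<close> (resp. \<open>q\<^sub>b\<^sub>,\<^sub>i\<close>).
\<close>

definition face_term ::
  "real ^ 'n::finite ^ 'n \<Rightarrow> real ^ 'n \<Rightarrow> real ^ 'n \<Rightarrow> 'n \<Rightarrow> real \<Rightarrow> real" where
  "face_term R a b i c =
     std_normal_density c * mvn_box (- {i}) a b (c *\<^sub>R column i R) (R_tilde1 R i)"

definition q_vec :: "real ^ 'n::finite ^ 'n \<Rightarrow> real ^ 'n \<Rightarrow> real ^ 'n \<Rightarrow> real ^ 'n" where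
  "q_vec R a b = (\<chi> i. face_term R a b i (a $ i)) - (\<chi> i. face_term R a b i (b $ i))"

text \<open>
  Conditional mean and covariance of the coordinates other than \<open>i\<close>, \<open>j\<close> of \<open>N\<^sub>p(0, R)\<close>, given
  that the coordinates \<open>i\<close>, \<open>j\<close> equal \<open>x\<close>, \<open>y\<close>. The factor \<open>inv_on {i, j} R\<close>, the inverse of the
  \<open>2 \<times> 2\<close> block of \<open>R\<close>, is needed for this: the formulas without it, which are sometimes found in
  print, are the conditional moments only if \<open>R $ i $ j = 0\<close> (the one-coordinate \<open>R_tilde1\<close> needs
  no such factor because \<open>R $ i $ i = 1\<close>).
\<close>

definition mu2 :: "real ^ 'n::finite ^ 'n \<Rightarrow> 'n \<Rightarrow> 'n \<Rightarrow> real \<Rightarrow> real \<Rightarrow> real ^ 'n" where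
  "mu2 R i j x y =
     (block (- {i, j}) {i, j} R ** inv_on {i, j} R) *v
       (\<chi> k. if k = i then x else if k = j then y else 0)"

definition R_tilde2 :: "real ^ 'n::finite ^ 'n \<Rightarrow> 'n \<Rightarrow> 'n \<Rightarrow> real ^ 'n ^ 'n" where
  "R_tilde2 R i j =
     block (- {i, j}) (- {i, j}) R -
     block (- {i, j}) {i, j} R ** inv_on {i, j} R ** block {i, j} (- {i, j}) R"

definition edge_term ::
  "real ^ 'n::finite ^ 'n \<Rightarrow> real ^ 'n \<Rightarrow> real ^ 'n \<Rightarrow> 'n \<Rightarrow> 'n \<Rightarrow> real \<Rightarrow> real \<Rightarrow> real" where
  "edge_term R a b i j x y =
     bvn_density x y (R $ i $ j) * mvn_box (- {i, j}) a b (mu2 R i j x y) (R_tilde2 R i j)"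

definition h_off :: "real ^ 'n::finite ^ 'n \<Rightarrow> real ^ 'n \<Rightarrow> real ^ 'n \<Rightarrow> 'n \<Rightarrow> 'n \<Rightarrow> real" where
  "h_off R a b i j =
     edge_term R a b i j (a $ i) (a $ j) - edge_term R a b i j (b $ i) (a $ j)
     - edge_term R a b i j (a $ i) (b $ j) + edge_term R a b i j (b $ i) (b $ j)"

definition H_mat :: "real ^ 'n::finite ^ 'n \<Rightarrow> real ^ 'n \<Rightarrow> real ^ 'n \<Rightarrow> real ^ 'n ^ 'n" where
  "H_mat R a b =
     (\<chi> i j. if i \<noteq> j then h_off R a b i j
             else a $ i * face_term R a b i (a $ i) - b $ i * face_term R a b i (b $ i)
                  - (\<Sum>k\<in>- {i}. R $ i $ k * h_off R a b k i))"

end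

theory Submission
  imports Defs
begin

text \<open>
  Let \<open>f\<close> be the density of the normal law with mean \<open>0\<close> and covariance \<open>R\<close>. Its gradient at \<open>x\<close> is
  \<open>- f x\<close> times \<open>inverse R *v x\<close>, and differentiating once more gives, for all \<open>x\<close>,

    \<open>x f = - R \<nabla>f\<close>   and   \<open>x x\<^sup>T f = f R + R (Hess f) R\<close>.

  Integrating both identities over the box and dividing by the probability \<open>L\<close> of the box reduces the two
  moments to the integrals of the first and second partial derivatives of \<open>f\<close>, and these are boundary
  terms. By Fubini and the fundamental theorem of calculus in one coordinate
  (\<open>box_integral_partial_derivative\<close>) the integral of \<open>\<partial>\<^sub>k f\<close> is the difference of the integrals of \<open>f\<close>
  over the two faces orthogonal to coordinate \<open>k\<close>, which is \<open>- q $ k\<close>; for \<open>k \<noteq> l\<close>, doing this in both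
  coordinates turns the integral of \<open>\<partial>\<^sub>k \<partial>\<^sub>l f\<close> into an alternating sum over four edges, which is the
  entry of \<open>H\<close>. The diagonal entries follow from the relation
  \<open>\<Sum>\<^sub>m R\<^sub>k\<^sub>m \<partial>\<^sub>m \<partial>\<^sub>k f = - \<partial>\<^sub>k (x\<^sub>k f)\<close>, in which only the term \<open>m = k\<close> is a pure second derivative
  (\<open>box_integral_partial2\<close>). Symmetry of \<open>H\<close> is then symmetry of second derivatives.

  A face or edge integral becomes a term of \<open>q\<close> or \<open>H\<close> by the factorisation of the joint density into a
  marginal and a conditional density (\<open>mvn_density_factor\<close>). It rests on block
  elimination: the inverse and the determinant of \<open>R\<close> are expressed through a principal block and its
  Schur complement, for an arbitrary set \<open>J\<close> of indices; faces correspond to one-element sets and edges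
  to two-element sets.

  Finally, the law of \<open>X\<close> is carried by a bounded box, so the moment generating function may be
  differentiated twice under the integral sign, by a direct estimate of the remainder of the exponential
  (\<open>has_derivative_exp_moment\<close>).
\<close>

section \<open>Schur complements\<close>

lemma matrix_diff_ldistrib: "A ** (B - C) = A ** B - A ** (C :: real ^ 'n ^ 'm)"
  for A :: "real ^ 'm ^ 'k"
  by (simp add: vec_eq_iff matrix_matrix_mult_def algebra_simps sum_subtractf)

lemma matrix_diff_rdistrib: "(A - B) ** C = A ** C - B ** (C :: real ^ 'n ^ 'm)"
  for A :: "real ^ 'm ^ 'k"
  by (simp add: vec_eq_iff matrix_matrix_mult_def algebra_simps sum_subtractf)

lemma matrix_add_rdistrib: "(A + B) ** C = A ** C + B ** (C :: real ^ 'n ^ 'm)"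
  for A :: "real ^ 'm ^ 'k"
  by (simp add: vec_eq_iff matrix_matrix_mult_def algebra_simps sum.distrib)

lemma matrix_inv_eq:
  fixes A B :: "real ^ 'n ^ 'n"
  assumes "A ** B = mat 1"
  shows "matrix_inv A = B"
proof -
  have "B ** A = mat 1"
    using assms by (simp add: matrix_left_right_inverse)
  with assms have "A ** matrix_inv A = mat 1 \<and> matrix_inv A ** A = mat 1"
    using someI[of "\<lambda>B. A ** B = mat 1 \<and> B ** A = mat 1" B] by (simp add: matrix_inv_def)
  then have "matrix_inv A ** (A ** B) = B"
    by (simp add: matrix_mul_assoc)
  with assms show ?thesis by simp
qed

lemma transpose_matrix_inv:
  fixes A :: "real ^ 'n ^ 'n"
  assumes "invertible A"
  shows "transpose (matrix_inv A) = matrix_inv (transpose A)"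
proof -
  obtain B where B: "A ** B = mat 1" "B ** A = mat 1"
    using assms by (auto simp: invertible_def)
  then have "transpose A ** transpose B = mat 1"
    by (metis matrix_transpose_mul transpose_mat)
  with B show ?thesis by (simp add: matrix_inv_eq)
qed

text \<open>
  This makes the cross terms in the block computations below vanish.
\<close>

lemma block_mult_disjoint:
  fixes A B :: "real ^ 'n::finite ^ 'n"
  assumes "J \<inter> K = {}"
  shows "block I J A ** block K I' B = 0"
  using assms by (auto simp: vec_eq_iff matrix_matrix_mult_def block_def intro!: sum.neutral)

lemma block_mult_mat1:
  fixes A :: "real ^ 'n::finite ^ 'n"
  shows "block I J A ** block J J (mat 1) = block I J A"
    and "block J J (mat 1) ** block J I A = block J I A"
proof -
  have "(\<Sum>k\<in>UNIV. block I J A $ i $ k * block J J (mat 1) $ k $ j) =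
      (\<Sum>k\<in>UNIV. if k = j then block I J A $ i $ j else 0)" for i j
    by (rule sum.cong) (auto simp: block_def mat_def)
  moreover have "(\<Sum>k\<in>UNIV. block J J (mat 1) $ i $ k * block J I A $ k $ j) =
      (\<Sum>k\<in>UNIV. if k = i then block J I A $ i $ j else 0)" for i j
    by (rule sum.cong) (auto simp: block_def mat_def)
  ultimately show "block I J A ** block J J (mat 1) = block I J A"
    "block J J (mat 1) ** block J I A = block J I A"
    by (simp_all add: vec_eq_iff matrix_matrix_mult_def)
qed

lemma transpose_block: "transpose (block I J A) = block J I (transpose A)"
  by (auto simp: vec_eq_iff block_def transpose_def)

lemma inv_on_transpose:
  fixes A :: "real ^ 'n::finite ^ 'n"
  assumes "det_on J A \<noteq> 0"
  shows "transpose (inv_on J A) = inv_on J (transpose A)"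
proof -
  have "transpose (completed J A) = completed J (transpose A)"
    by (auto simp: vec_eq_iff completed_nth transpose_def)
  then show ?thesis
    using assms transpose_matrix_inv[of "completed J A"]
    by (simp add: inv_on_def transpose_block det_on_def invertible_det_nz)
qed

text \<open>
  Of all permutations only the identity contributes: a permutation that gives a nonzero product fixes
  the rows in \<open>J\<close>, hence maps the remaining rows to the remaining columns, where the matrix is the
  identity.
\<close>

lemma det_unipotent_block:
  fixes N :: "real ^ 'n::finite ^ 'n"
  shows "det (mat 1 + block (- J) J N) = 1"
proof -
  let ?U = "mat 1 + block (- J) J N"
  let ?f = "\<lambda>\<pi>. of_int (sign \<pi>) * (\<Prod>i\<in>UNIV. ?U $ i $ \<pi> i)"
  have zero: "?f \<pi> = 0" if p: "\<pi> permutes (UNIV :: 'n set)" "\<pi> \<noteq> id" for \<pi>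
  proof -
    have "\<exists>k. ?U $ k $ \<pi> k = 0"
    proof (cases "\<exists>k\<in>J. \<pi> k \<noteq> k")
      case True
      then obtain k where "k \<in> J" "\<pi> k \<noteq> k" by blast
      then show ?thesis
        by (intro exI[of _ k]) (simp add: block_def mat_def)
    next
      case False
      from p obtain k where k: "\<pi> k \<noteq> k" by fastforce
      have "\<pi> k \<notin> J"
        using False k p(1) by (metis permutes_def)
      with k show ?thesis
        by (intro exI[of _ k]) (simp add: block_def mat_def)
    qed
    then show ?thesis by simp
  qed
  have "det ?U = (\<Sum>\<pi>\<in>{id}. ?f \<pi>)"
    unfolding det_def
    by (rule sum.mono_neutral_right) (use zero in \<open>auto simp: finite_permutations permutes_id\<close>)
  then show ?thesis
    by (simp add: block_def mat_def sign_id)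
qed

text \<open>
  The Schur complement of the block with index set \<open>J\<close>: for a covariance matrix \<open>A\<close>, the conditional
  covariance of the coordinates outside \<open>J\<close> given those in \<open>J\<close>.
\<close>

definition schur :: "'n::finite set \<Rightarrow> real ^ 'n ^ 'n \<Rightarrow> real ^ 'n ^ 'n" where
  "schur J A = block (- J) (- J) A - block (- J) J A ** inv_on J A ** block J (- J) A"

lemma block_schur: "block (- J) (- J) (schur J A) = schur J A"
  by (auto simp: schur_def vec_eq_iff matrix_matrix_mult_def block_def intro!: sum.neutral)

lemma block_inv_on: "block J J (inv_on J A) = inv_on J A"
  by (simp add: inv_on_def block_def vec_eq_iff)

context
  fixes J :: "'n::finite set" and A :: "real ^ 'n ^ 'n" and l u :: "real ^ 'n ^ 'n"
  assumes nz: "det_on J A \<noteq> 0"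
  defines "l \<equiv> block (- J) J A ** inv_on J A" and "u \<equiv> inv_on J A ** block J (- J) A"
begin

lemma block_l: "block (- J) J l = l" and block_u: "block J (- J) u = u"
  unfolding l_def u_def
  by (auto simp: vec_eq_iff matrix_matrix_mult_def block_def inv_on_def intro!: sum.neutral)

text \<open>
  Block elimination: splitting off the unipotent factors \<open>1 + l\<close> and \<open>1 + u\<close> leaves a block diagonal
  matrix. Determinant, inverse and quadratic form are read off from this
  factorisation. In terms of the normal law, \<open>l\<close> is the matrix of regression coefficients of the
  coordinates outside \<open>J\<close> on those in \<open>J\<close>.
\<close>

lemma schur_ldu:
  "A = (mat 1 + l) ** (block J J A + schur J A) ** (mat 1 + u)"
proof -
  have lD: "l ** block J J A = block (- J) J A"
    using inv_on_left[OF nz] by (simp add: l_def flip: matrix_mul_assoc) (simp add: block_mult_mat1)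
  have Du: "block J J A ** u = block J (- J) A"
    using inv_on_right[OF nz] by (simp add: u_def matrix_mul_assoc block_mult_mat1)
  have lS: "l ** schur J A = 0"
    using block_mult_disjoint[of J "- J" "- J" l "- J" "schur J A"]
    by (simp add: block_l block_schur)
  have Su: "schur J A ** u = 0"
    using block_mult_disjoint[of "- J" J "- J" "schur J A" "- J" u]
    by (simp add: block_u block_schur)
  have Bu: "block (- J) J A ** u = block (- J) (- J) A - schur J A"
    by (simp add: u_def schur_def matrix_mul_assoc)
  have "(mat 1 + l) ** (block J J A + schur J A) ** (mat 1 + u) =
      block J J A + block (- J) J A + block J (- J) A + block (- J) (- J) A"
    by (simp add: matrix_add_ldistrib matrix_add_rdistrib lD Du lS Su Bu)
  also have "\<dots> = A"
    by (auto simp: vec_eq_iff block_def)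
  finally show ?thesis ..
qed

lemma det_schur: "det A = det_on J A * det_on (- J) (schur J A)"
proof -
  have eq: "block J J A + schur J A = completed J A ** completed (- J) (schur J A)"
  proof -
    have "completed J A ** completed (- J) (schur J A) =
       (block J J A + block (- J) (- J) (mat 1)) ** (schur J A + block J J (mat 1))"
      unfolding completed_def by (simp add: block_schur)
    also have "\<dots> = block J J A + schur J A"
      using block_mult_disjoint[of J "- J" J A "- J" "schur J A"]
        block_mult_disjoint[of "- J" "J" "- J" "mat 1" J "mat 1"]
        block_mult_mat1(2)[of "- J" "- J" "schur J A"]
      by (simp add: matrix_add_ldistrib matrix_add_rdistrib block_schur block_mult_mat1)
    finally show ?thesis ..
  qed
  have "det (mat 1 + l) = 1"
    using det_unipotent_block[of J l] by (simp add: block_l)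
  moreover have "det (mat 1 + u) = 1"
    using det_unipotent_block[of "- J" u] by (simp add: block_u)
  ultimately show ?thesis
    by (subst schur_ldu) (simp add: det_mul eq det_on_def)
qed

lemma matrix_inv_schur:
  assumes "det A \<noteq> 0"
  shows "matrix_inv A =
    (mat 1 - u) ** (inv_on J A + inv_on (- J) (schur J A)) ** (mat 1 - l)"
proof (rule matrix_inv_eq)
  let ?S = "schur J A" and ?P = "inv_on J A" and ?Q = "inv_on (- J) (schur J A)"
  have "det_on (- J) ?S \<noteq> 0" using assms det_schur by auto
  from inv_on_right[OF this] have SQ: "?S ** ?Q = block (- J) (- J) (mat 1)"
    by (simp add: block_schur)
  have uu: "u ** u = 0"
    using block_mult_disjoint[of "- J" J J u "- J" u] by (simp add: block_u)
  have ll: "l ** l = 0"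
    using block_mult_disjoint[of J "- J" "- J" l J l] by (simp add: block_l)
  have DQ: "block J J A ** ?Q = 0"
    using block_mult_disjoint[of J "- J" J A "- J" ?Q] by (simp add: block_inv_on)
  have SP: "?S ** ?P = 0"
    using block_mult_disjoint[of "- J" J "- J" ?S J ?P] by (simp add: block_inv_on block_schur)
  have I: "block J J (mat 1) + block (- J) (- J) (mat 1) = (mat 1 :: real ^ 'n ^ 'n)"
    by (auto simp: vec_eq_iff block_def mat_def)
  have mid: "(block J J A + ?S) ** (?P + ?Q) = mat 1"
    by (simp add: matrix_add_ldistrib matrix_add_rdistrib SQ DQ SP inv_on_right[OF nz] I)
  have u: "(mat 1 + u) ** (mat 1 - u) = mat 1"
    by (simp add: matrix_diff_ldistrib matrix_add_rdistrib uu)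
  have l: "(mat 1 + l) ** (mat 1 - l) = mat 1"
    by (simp add: matrix_diff_ldistrib matrix_add_rdistrib ll)
  have "A ** ((mat 1 - u) ** (?P + ?Q) ** (mat 1 - l)) =
      (mat 1 + l) ** (block J J A + ?S) ** ((mat 1 + u) ** (mat 1 - u)) ** (?P + ?Q) ** (mat 1 - l)"
    by (subst schur_ldu) (simp add: matrix_mul_assoc)
  also have "\<dots> = (mat 1 + l) ** ((block J J A + ?S) ** (?P + ?Q)) ** (mat 1 - l)"
    unfolding u by (simp add: matrix_mul_assoc)
  also have "\<dots> = mat 1"
    unfolding mid by (simp add: l)
  finally show "A ** ((mat 1 - u) ** (?P + ?Q) ** (mat 1 - l)) = mat 1" .
qed

text \<open>
  Completing the square: \<open>l *v x\<close> is the conditional mean of the coordinates outside \<open>J\<close>. Both outer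
  factors of the inverse turn \<open>x\<close> into \<open>x - l *v x\<close>, because \<open>transpose u = l\<close> for symmetric \<open>A\<close>.
\<close>

lemma quadratic_form_schur:
  assumes sym: "transpose A = A" and "det A \<noteq> 0"
  shows "x \<bullet> (matrix_inv A *v x) =
    x \<bullet> (inv_on J A *v x) + (x - l *v x) \<bullet> (inv_on (- J) (schur J A) *v (x - l *v x))"
proof -
  let ?P = "inv_on J A" and ?Q = "inv_on (- J) (schur J A)"
  have tu: "transpose (mat 1 - u) = mat 1 - l"
  proof -
    have "transpose u = l"
      using inv_on_transpose[OF nz]
      by (simp add: u_def l_def matrix_transpose_mul transpose_block sym)
    then show ?thesis
      by (auto simp: vec_eq_iff transpose_def mat_def)
  qed
  have Pl: "?P ** l = 0"
    using block_mult_disjoint[of J "- J" J ?P J l] by (simp add: block_inv_on block_l)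
  have uP: "u ** ?P = 0"
    using block_mult_disjoint[of "- J" J J u J ?P] by (simp add: block_inv_on block_u)
  have P: "(mat 1 - u) ** ?P ** (mat 1 - l) = ?P"
    by (simp add: matrix_diff_ldistrib matrix_diff_rdistrib uP Pl)
  have "matrix_inv A *v x =
      ((mat 1 - u) ** ?P ** (mat 1 - l)) *v x + ((mat 1 - u) ** ?Q ** (mat 1 - l)) *v x"
    unfolding matrix_inv_schur[OF assms(2)]
    by (simp add: matrix_add_ldistrib matrix_add_rdistrib matrix_vector_mult_add_rdistrib)
  also have "\<dots> = ?P *v x + (mat 1 - u) *v (?Q *v ((mat 1 - l) *v x))"
    unfolding P by (simp add: matrix_vector_mul_assoc matrix_mul_assoc)
  finally have "x \<bullet> (matrix_inv A *v x) =
      x \<bullet> (?P *v x) + x \<bullet> ((mat 1 - u) *v (?Q *v ((mat 1 - l) *v x)))"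
    by (simp add: inner_add_right)
  also have "x \<bullet> ((mat 1 - u) *v (?Q *v ((mat 1 - l) *v x))) =
      ((mat 1 - l) *v x) \<bullet> (?Q *v ((mat 1 - l) *v x))"
    by (metis tu dot_lmul_matrix transpose_matrix_vector transpose_transpose)
  also have "(mat 1 - l) *v x = x - l *v x"
    by (simp add: matrix_vector_mult_diff_rdistrib)
  finally show ?thesis .
qed

end

section \<open>Positive definite matrices\<close>

text \<open>
  If the quadratic form vanishes at \<open>x\<close>, it is minimal there, so moving from \<open>x\<close> in the direction
  \<open>A *v x\<close> cannot lower it, whichever the sign of the step. To first order a step of size \<open>s\<close> adds
  \<open>2 * s * norm (A *v x) ^ 2\<close>, hence \<open>A *v x = 0\<close>.
\<close>

lemma psd_invertible_pos_def:
  fixes A :: "real ^ 'n::finite ^ 'n"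
  assumes sym: "transpose A = A" and psd: "\<And>x. 0 \<le> x \<bullet> (A *v x)" and inv: "invertible A"
    and "x \<noteq> 0"
  shows "0 < x \<bullet> (A *v x)"
proof (rule ccontr)
  let ?y = "A *v x"
  assume "\<not> 0 < x \<bullet> ?y"
  then have 0: "x \<bullet> ?y = 0" using psd[of x] by linarith
  have xy: "x \<bullet> (A *v ?y) = ?y \<bullet> ?y"
    by (metis dot_lmul_matrix sym transpose_matrix_vector)
  define K where "K = ?y \<bullet> (A *v ?y)"
  have K: "0 \<le> K" unfolding K_def by (rule psd)
  have "?y = 0"
  proof -
    have all: "0 \<le> 2 * s * (?y \<bullet> ?y) + s\<^sup>2 * K" for s :: real
    proof -
      have "0 \<le> (x + s *\<^sub>R ?y) \<bullet> (A *v (x + s *\<^sub>R ?y))"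
        by (rule psd)
      also have "\<dots> = 2 * s * (?y \<bullet> ?y) + s\<^sup>2 * K"
        by (simp add: matrix_vector_right_distrib matrix_vector_mult_scaleR inner_add_left
            inner_add_right 0 xy K_def power2_eq_square distrib_left mult.assoc)
      finally show ?thesis .
    qed
    \<comment> \<open>a negative step, short enough for the linear term to dominate the quadratic one\<close>
    define s where "s = - (?y \<bullet> ?y) / (1 + K)"
    have s: "s * (1 + K) = - (?y \<bullet> ?y)"
      using K by (simp add: s_def)
    have "0 \<le> (2 * s * (?y \<bullet> ?y) + s\<^sup>2 * K) * (1 + K)\<^sup>2"
      by (intro mult_nonneg_nonneg all) simp
    also have "\<dots> = - ((?y \<bullet> ?y)\<^sup>2 * (2 + K))"
      using s by algebra
    finally have "(?y \<bullet> ?y)\<^sup>2 * (2 + K) \<le> 0" by simp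
    with K have "(?y \<bullet> ?y)\<^sup>2 \<le> 0"
      by (smt (verit) mult_pos_pos)
    then show ?thesis by simp
  qed
  then have "x = 0"
    using inv by (metis invertible_def matrix_vector_mul_assoc matrix_vector_mul_lid
        matrix_vector_mult_0_right)
  with \<open>x \<noteq> 0\<close> show False by simp
qed

text \<open>
  On the segment from the identity to \<open>A\<close> all matrices are positive definite, so the determinant has
  no zero there and keeps the sign that it has at the identity.
\<close>

lemma det_pos_def:
  fixes A :: "real ^ 'n::finite ^ 'n"
  assumes pos: "\<And>x. x \<noteq> 0 \<Longrightarrow> 0 < x \<bullet> (A *v x)"
  shows "0 < det A"
proof (rule ccontr)
  assume neg: "\<not> 0 < det A"
  define B where "B t = t *\<^sub>R A + (1 - t) *\<^sub>R mat 1" for t :: real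
  have cont: "continuous_on {0..1} (\<lambda>t. det (B t))"
    unfolding B_def det_def by (simp, intro continuous_intros)
  obtain t where t: "0 \<le> t" "t \<le> 1" "det (B t) = 0"
    using IVT2'[of "\<lambda>t. det (B t)" 1 0 0] cont neg by (auto simp: B_def)
  then obtain x where x: "x \<noteq> 0" "B t *v x = 0"
    by (metis invertible_det_nz invertible_left_inverse matrix_left_invertible_ker)
  have "0 = t * (x \<bullet> (A *v x)) + (1 - t) * (x \<bullet> x)"
    using arg_cong[OF x(2), of "\<lambda>v. x \<bullet> v"]
    by (simp add: B_def matrix_vector_mult_add_rdistrib scaleR_matrix_vector_assoc[symmetric]
        inner_add_right)
  moreover have "0 \<le> t * (x \<bullet> (A *v x))" "0 \<le> (1 - t) * (x \<bullet> x)"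
    using t pos[OF x(1)] by simp_all
  ultimately have "t * (x \<bullet> (A *v x)) = 0" "(1 - t) * (x \<bullet> x) = 0" by linarith+
  with pos[OF x(1)] x(1) show False by simp
qed

text \<open>
  Completing a principal block with the identity preserves positive definiteness, as the quadratic form
  splits into that of \<open>A\<close> on the coordinates in \<open>J\<close> and the squared norm of the others.
\<close>

lemma det_on_pos_def:
  fixes A :: "real ^ 'n::finite ^ 'n"
  assumes pos: "\<And>x. x \<noteq> 0 \<Longrightarrow> 0 < x \<bullet> (A *v x)"
  shows "0 < det_on J A"
  unfolding det_on_def
proof (rule det_pos_def)
  fix x :: "real ^ 'n" assume "x \<noteq> 0"
  define y z where "y = (\<chi> k. if k \<in> J then x $ k else 0)"
    and "z = (\<chi> k. if k \<in> J then 0 else x $ k)"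
  have eq: "completed J A $ i $ j * x $ i * x $ j = A $ i $ j * y $ i * y $ j + mat 1 $ i $ j * z $ i * z $ j"
    for i j
    by (auto simp: completed_nth y_def z_def mat_def)
  have quad: "v \<bullet> (M *v v) = (\<Sum>i\<in>UNIV. \<Sum>j\<in>UNIV. M $ i $ j * v $ i * v $ j)"
    for v and M :: "real ^ 'n ^ 'n"
    by (simp add: inner_vec_def matrix_vector_mult_def sum_distrib_left mult_ac)
  have "x \<bullet> (completed J A *v x) = y \<bullet> (A *v y) + z \<bullet> (mat 1 *v z)"
    unfolding quad by (simp add: eq sum.distrib)
  then have *: "x \<bullet> (completed J A *v x) = y \<bullet> (A *v y) + z \<bullet> z" by simp
  show "0 < x \<bullet> (completed J A *v x)"
  proof (cases "y = 0")
    case True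
    have "x = y + z" by (simp add: vec_eq_iff y_def z_def)
    with True \<open>x \<noteq> 0\<close> have "z \<noteq> 0" by simp
    then show ?thesis unfolding * True by simp
  next
    case False
    then show ?thesis unfolding * using pos[of y] by (simp add: add_pos_nonneg)
  qed
qed

section \<open>Marginal and conditional normal densities\<close>

lemma mvn_density_cong:
  assumes "\<And>k. k \<in> J \<Longrightarrow> x $ k - \<mu> $ k = x' $ k - \<mu>' $ k"
  shows "mvn_density J \<mu> \<Sigma> x = mvn_density J \<mu>' \<Sigma> x'"
proof -
  have "(x - \<mu>) \<bullet> (inv_on J \<Sigma> *v (x - \<mu>)) = (x' - \<mu>') \<bullet> (inv_on J \<Sigma> *v (x' - \<mu>'))"
    unfolding inner_vec_def matrix_vector_mult_def
  proof (intro sum.cong refl)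
    fix k
    show "(x - \<mu>) $ k \<bullet> (\<chi> i. \<Sum>j\<in>UNIV. inv_on J \<Sigma> $ i $ j * (x - \<mu>) $ j) $ k =
        (x' - \<mu>') $ k \<bullet> (\<chi> i. \<Sum>j\<in>UNIV. inv_on J \<Sigma> $ i $ j * (x' - \<mu>') $ j) $ k"
    proof (cases "k \<in> J")
      case True
      then show ?thesis
        by (auto simp: assms inv_on_def block_def intro!: sum.cong)
    next
      case False
      then show ?thesis by (simp add: inv_on_def block_def)
    qed
  qed
  then show ?thesis
    by (simp add: mvn_density_def)
qed

text \<open>
  The joint density is the marginal density of the coordinates in \<open>J\<close> times the conditional density of
  the others: completing the square splits the exponent, and the determinant of the Schur complement
  splits the normalising constant.
\<close>

lemma mvn_density_factor:
  fixes A :: "real ^ 'n::finite ^ 'n"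
  assumes "transpose A = A" "det A \<noteq> 0" "det_on J A \<noteq> 0"
  shows "mvn_density UNIV 0 A x = mvn_density J 0 A x *
    mvn_density (- J) ((block (- J) J A ** inv_on J A) *v x) (schur J A) x"
proof -
  let ?y = "x - (block (- J) J A ** inv_on J A) *v x"
  have card: "CARD('n) = card J + card (- J)"
    by (metis Compl_partition card_Un_disjoint Compl_disjoint finite)
  have "sqrt ((2 * pi) ^ CARD('n) * det_on UNIV A) =
      sqrt ((2 * pi) ^ card J * det_on J A) *
      sqrt ((2 * pi) ^ card (- J) * det_on (- J) (schur J A))"
    unfolding det_on_UNIV det_schur[OF assms(3)] card power_add
    by (simp add: real_sqrt_mult mult_ac)
  moreover have "exp (- (x \<bullet> (inv_on UNIV A *v x)) / 2) =
      exp (- (x \<bullet> (inv_on J A *v x)) / 2) *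
      exp (- (?y \<bullet> (inv_on (- J) (schur J A) *v ?y)) / 2)"
    unfolding inv_on_UNIV quadratic_form_schur[OF assms(3,1,2)]
    by (simp add: diff_divide_distrib flip: exp_add)
  ultimately show ?thesis
    by (simp add: mvn_density_def)
qed

lemma inv_on_singleton:
  fixes A :: "real ^ 'n::finite ^ 'n"
  assumes "A $ i $ i = 1"
  shows "inv_on {i} A = block {i} {i} (mat 1)"
proof -
  have "completed {i} A = mat 1"
    using assms by (auto simp: vec_eq_iff completed_nth mat_def)
  then show ?thesis
    using matrix_inv_eq[of "mat 1 :: real^'n^'n" "mat 1"] by (simp add: inv_on_def)
qed

lemma det_on_singleton:
  fixes A :: "real ^ 'n::finite ^ 'n"
  shows "det_on {i} A = A $ i $ i"
proof -
  have "{\<pi>. \<pi> permutes {i}} = {id}" by (auto simp: permutes_sing permutes_id)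
  then show ?thesis by (simp add: det_on_leibniz sign_id)
qed

text \<open>
  The factor \<open>inv_on {i} R\<close> of the Schur complement disappears, because it is \<open>1\<close> when the variance of
  coordinate \<open>i\<close> is \<open>1\<close>.
\<close>

lemma R_tilde1_eq_schur:
  assumes "R $ i $ i = 1"
  shows "R_tilde1 R i = schur {i} R"
  by (simp add: R_tilde1_def schur_def inv_on_singleton[OF assms] block_mult_mat1)

lemma R_tilde2_eq_schur: "R_tilde2 R i j = schur {i, j} R"
  by (simp add: R_tilde2_def schur_def)

lemma mvn_density_singleton:
  fixes A :: "real ^ 'n::finite ^ 'n"
  assumes "A $ i $ i = 1"
  shows "mvn_density {i} 0 A x = std_normal_density (x $ i)"
proof -
  have P: "(inv_on {i} A *v x) $ k = (if k = i then x $ i else 0)" for k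
    using assms
    by (auto simp: inv_on_singleton matrix_vector_mult_def block_def mat_def sum.delta
        if_distrib[where f="\<lambda>u. u * _"] cong: if_cong)
  have "x \<bullet> (inv_on {i} A *v x) = (x $ i)\<^sup>2"
    unfolding inner_vec_def P
    by (simp add: power2_eq_square if_distrib cong: if_cong)
  then show ?thesis
    by (simp add: mvn_density_def det_on_singleton assms std_normal_density_def)
qed

lemma det_on_pair:
  fixes A :: "real ^ 'n::finite ^ 'n"
  assumes "i \<noteq> j"
  shows "det_on {i, j} A = A $ i $ i * A $ j $ j - A $ i $ j * A $ j $ i"
proof -
  have "{\<pi>. \<pi> permutes {i, j}} = {id, Transposition.transpose i j}"
    by (auto simp: permutes_doubleton_iff)
  moreover have "id \<noteq> Transposition.transpose i j"
    using assms by (metis id_apply transpose_apply_first)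
  ultimately show ?thesis
    using assms by (simp add: det_on_leibniz sign_id sign_swap_id)
qed

lemma mvn_density_pair:
  fixes A :: "real ^ 'n::finite ^ 'n"
  assumes sym: "transpose A = A" and diag: "A $ i $ i = 1" "A $ j $ j = 1"
    and ij: "i \<noteq> j" and nz: "det_on {i, j} A \<noteq> 0"
  shows "mvn_density {i, j} 0 A x = bvn_density (x $ i) (x $ j) (A $ i $ j)"
proof -
  define \<rho> where "\<rho> = A $ i $ j"
  have ji: "A $ j $ i = \<rho>"
    using sym by (metis \<rho>_def transpose_def vec_lambda_beta)
  have d: "det_on {i, j} A = 1 - \<rho>\<^sup>2"
    using ij diag ji by (simp add: det_on_pair power2_eq_square flip: \<rho>_def)
  with nz have d0: "1 - \<rho>\<^sup>2 \<noteq> 0" by simp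
  let ?P = "inv_on {i, j} A"
  have sum2: "(\<Sum>k\<in>UNIV. f k) = f i + f j" if "\<And>k. k \<notin> {i, j} \<Longrightarrow> f k = 0" for f :: "'n \<Rightarrow> real"
  proof -
    have "(\<Sum>k\<in>UNIV. f k) = (\<Sum>k\<in>{i, j}. f k)"
      by (rule sum.mono_neutral_right) (use that in auto)
    with ij show ?thesis by simp
  qed
  \<comment> \<open>the linear system that determines the inverse of the \<open>2 \<times> 2\<close> block\<close>
  have eqs: "A $ k $ i * ?P $ i $ l + A $ k $ j * ?P $ j $ l = (if k = l then 1 else 0)"
    if "k \<in> {i, j}" "l \<in> {i, j}" for k l
  proof -
    have "(block {i, j} {i, j} A ** ?P) $ k $ l = A $ k $ i * ?P $ i $ l + A $ k $ j * ?P $ j $ l"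
      unfolding matrix_matrix_mult_def vec_lambda_beta
      by (subst sum2) (use that in \<open>auto simp: block_def\<close>)
    then show ?thesis
      unfolding inv_on_right[OF nz] using that by (auto simp: block_def mat_def)
  qed
  have "?P $ i $ i + \<rho> * ?P $ j $ i = 1" "\<rho> * ?P $ i $ i + ?P $ j $ i = 0"
    "?P $ i $ j + \<rho> * ?P $ j $ j = 0" "\<rho> * ?P $ i $ j + ?P $ j $ j = 1"
    using eqs[of i i] eqs[of j i] eqs[of i j] eqs[of j j] ij ji diag by (auto simp flip: \<rho>_def)
  then have P: "?P $ j $ i = - \<rho> * ?P $ i $ i" "(1 - \<rho>\<^sup>2) * ?P $ i $ i = 1"
    "?P $ i $ j = - \<rho> * ?P $ j $ j" "(1 - \<rho>\<^sup>2) * ?P $ j $ j = 1"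
    by (algebra | linarith)+
  have P': "?P $ i $ i = 1 / (1 - \<rho>\<^sup>2)" "?P $ j $ j = 1 / (1 - \<rho>\<^sup>2)"
    using P(2,4) d0 by (simp_all add: field_simps)
  have Px: "(?P *v x) $ k = ?P $ k $ i * x $ i + ?P $ k $ j * x $ j" for k
    unfolding matrix_vector_mult_def vec_lambda_beta
    by (rule sum2) (simp add: inv_on_def block_def)
  have "x \<bullet> (?P *v x) = x $ i * (?P $ i $ i * x $ i + ?P $ i $ j * x $ j)
      + x $ j * (?P $ j $ i * x $ i + ?P $ j $ j * x $ j)"
    unfolding inner_vec_def inner_real_def Px
    by (rule sum2) (simp add: inv_on_def block_def)
  also have "\<dots> = ((x $ i)\<^sup>2 - 2 * \<rho> * x $ i * x $ j + (x $ j)\<^sup>2) / (1 - \<rho>\<^sup>2)"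
    unfolding P(1,3) P' by (simp add: divide_inverse algebra_simps power2_eq_square)
  finally have q: "x \<bullet> (?P *v x) = ((x $ i)\<^sup>2 - 2 * \<rho> * x $ i * x $ j + (x $ j)\<^sup>2) / (1 - \<rho>\<^sup>2)" .
  have "sqrt ((2 * pi) ^ card {i, j} * det_on {i, j} A) = 2 * pi * sqrt (1 - \<rho>\<^sup>2)"
    using ij by (simp add: d real_sqrt_mult power2_eq_square[symmetric])
  moreover have "- (x \<bullet> (?P *v x)) / 2 =
      - ((x $ i)\<^sup>2 - 2 * \<rho> * x $ i * x $ j + (x $ j)\<^sup>2) / (2 * (1 - \<rho>\<^sup>2))"
    unfolding q by (simp only: minus_divide_left divide_divide_eq_left mult.commute)
  ultimately show ?thesis
    unfolding mvn_density_def bvn_density_def \<rho>_def[symmetric] by simp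
qed

definition vec_upd :: "real ^ 'n \<Rightarrow> 'n \<Rightarrow> real \<Rightarrow> real ^ 'n" where
  "vec_upd x i c = (\<chi> k. if k = i then c else x $ k)"

lemma vec_upd_nth [simp]: "vec_upd x i c $ k = (if k = i then c else x $ k)"
  by (simp add: vec_upd_def)

text \<open>
  The restrictions of the density to a face and to an edge of the box. These are the facts that turn the
  boundary values of the fundamental theorem of calculus into the entries of \<open>q\<close> and \<open>H\<close>.
\<close>

lemma mvn_density_face:
  fixes R :: "real ^ 'n::finite ^ 'n"
  assumes sym: "transpose R = R" and diag: "R $ i $ i = 1" and "det R \<noteq> 0"
  shows "mvn_density UNIV 0 R (vec_upd x i c) =
    std_normal_density c * mvn_density (- {i}) (c *\<^sub>R column i R) (R_tilde1 R i) x"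
proof -
  have nz: "det_on {i} R \<noteq> 0" by (simp add: det_on_singleton diag)
  have m: "((block (- {i}) {i} R ** inv_on {i} R) *v vec_upd x i c) $ k = (c *\<^sub>R column i R) $ k"
    if "k \<noteq> i" for k
  proof -
    have "(\<Sum>l\<in>UNIV. block (- {i}) {i} R $ k $ l * vec_upd x i c $ l) =
        (\<Sum>l\<in>UNIV. if l = i then c * R $ k $ i else 0)"
      by (rule sum.cong) (use that in \<open>auto simp: block_def\<close>)
    then show ?thesis
      by (simp add: inv_on_singleton[OF diag] block_mult_mat1 matrix_vector_mult_def column_def)
  qed
  show ?thesis
    unfolding mvn_density_factor[OF sym assms(3) nz] mvn_density_singleton[OF diag]
      R_tilde1_eq_schur[OF diag]
    by (simp, rule disjI2, rule mvn_density_cong) (simp add: m)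
qed

lemma mvn_density_edge:
  fixes R :: "real ^ 'n::finite ^ 'n"
  assumes sym: "transpose R = R" and diag: "R $ i $ i = 1" "R $ j $ j = 1" and "det R \<noteq> 0"
    and ij: "i \<noteq> j" and nz: "det_on {i, j} R \<noteq> 0"
  shows "mvn_density UNIV 0 R (vec_upd (vec_upd x i c) j d) =
    bvn_density c d (R $ i $ j) * mvn_density (- {i, j}) (mu2 R i j c d) (R_tilde2 R i j) x"
proof -
  let ?l = "block (- {i, j}) {i, j} R ** inv_on {i, j} R"
  have "?l *v vec_upd (vec_upd x i c) j d = mu2 R i j c d"
    using ij unfolding mu2_def
    by (auto simp: vec_eq_iff matrix_vector_mult_def matrix_matrix_mult_def inv_on_def block_def
        intro!: sum.cong)
  then show ?thesis
    unfolding mvn_density_factor[OF sym assms(4) nz] mvn_density_pair[OF sym diag ij nz]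
      R_tilde2_eq_schur
    using ij by (simp, intro disjI2 mvn_density_cong) simp
qed

section \<open>Integrals over boxes\<close>

text \<open>
  Points of the product space with index set \<open>J\<close> take the constant value \<open>undefined\<close> outside \<open>J\<close>, so
  the coordinates outside \<open>J\<close> are constant functions, and in particular measurable and bounded.
\<close>

lemma vec_lambda_measurable:
  "(\<lambda>x. \<chi> k. x k) \<in> borel_measurable (\<Pi>\<^sub>M k\<in>J. (lborel :: real measure))"
  for J :: "'n::finite set"
proof -
  have "(\<lambda>x. x k) \<in> borel_measurable (\<Pi>\<^sub>M k\<in>J. (lborel :: real measure))" for k
  proof (cases "k \<in> J")
    case True
    then show ?thesis by simp
  next
    case False
    then have "(\<lambda>x. x k) \<in> borel_measurable (\<Pi>\<^sub>M k\<in>J. (lborel :: real measure)) \<longleftrightarrow>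
        (\<lambda>x. undefined :: real) \<in> borel_measurable (\<Pi>\<^sub>M k\<in>J. (lborel :: real measure))"
      by (intro measurable_cong) (auto simp: space_PiM PiE_def extensional_def)
    then show ?thesis by simp
  qed
  then show ?thesis
    by (subst borel_measurable_euclidean_space) (auto simp: Basis_vec_def inner_axis)
qed

interpretation lebesgue_product: product_sigma_finite "\<lambda>_ :: 'n. lborel :: real measure"
  by (simp add: product_sigma_finite_def lborel.sigma_finite_measure_axioms)

lemma lborel_eq_distr_PiM:
  "(lborel :: (real ^ 'n::finite) measure) = distr (\<Pi>\<^sub>M k\<in>UNIV. lborel) borel (\<lambda>x. \<chi> k. x k)"
proof (rule lborel_eqI)
  fix l u :: "real ^ 'n"
  assume le: "\<And>b. b \<in> Basis \<Longrightarrow> l \<bullet> b \<le> u \<bullet> b"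
  have le: "l $ k \<le> u $ k" for k
    using le[of "axis k 1"] by (auto simp: Basis_vec_def inner_axis)
  have "(\<lambda>x. \<chi> k. x k) -` box l u \<inter> space (\<Pi>\<^sub>M k\<in>UNIV. lborel) = (\<Pi>\<^sub>E k\<in>UNIV. {l $ k<..<u $ k})"
    by (auto simp: mem_box_cart space_PiM PiE_iff)
  then have "emeasure (distr (\<Pi>\<^sub>M k\<in>UNIV. lborel) borel (\<lambda>x. \<chi> k. x k)) (box l u) =
      (\<Prod>k\<in>UNIV. ennreal (u $ k - l $ k))"
    using le by (simp add: emeasure_distr vec_lambda_measurable lebesgue_product.emeasure_PiM)
  also have "\<dots> = ennreal (\<Prod>k\<in>UNIV. u $ k - l $ k)"
    using le by (intro prod_ennreal) simp
  also have "(\<Prod>k\<in>UNIV. u $ k - l $ k) = (\<Prod>b\<in>Basis. (u - l) \<bullet> b)"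
    unfolding Basis_vec_def
    by (subst prod.UNION_disjoint) (auto simp: axis_eq_axis inner_axis)
  finally show "emeasure (distr (\<Pi>\<^sub>M k\<in>UNIV. lborel) borel (\<lambda>x. \<chi> k. x k)) (box l u) =
      ennreal (\<Prod>b\<in>Basis. (u - l) \<bullet> b)" .
qed simp

text \<open>
  As in \<open>mvn_box\<close>, the vector at which \<open>g\<close> is evaluated has the value \<open>undefined\<close> in the coordinates
  outside \<open>J\<close>. The definition is therefore meaningful only if these coordinates do not matter to \<open>g\<close>,
  for instance because they have been overwritten by \<open>vec_upd\<close>.
\<close>

definition box_integral ::
  "'n::finite set \<Rightarrow> real ^ 'n \<Rightarrow> real ^ 'n \<Rightarrow> (real ^ 'n \<Rightarrow> real) \<Rightarrow> real" where
  "box_integral J a b g =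
     (LINT x : (\<Pi>\<^sub>E k\<in>J. {a $ k .. b $ k}) | (\<Pi>\<^sub>M k\<in>J. lborel). g (\<chi> k. x k))"

lemma mvn_box_eq: "mvn_box J a b \<mu> \<Sigma> = box_integral J a b (mvn_density J \<mu> \<Sigma>)"
  by (simp add: mvn_box_def box_integral_def)

lemma box_in_sets:
  "(\<Pi>\<^sub>E k\<in>J. {a $ k .. b $ k}) \<in> sets (\<Pi>\<^sub>M k\<in>J. (lborel :: real measure))"
  for J :: "'n::finite set"
  by (intro sets_PiM_I_finite) auto

lemma box_integrable:
  fixes g :: "real ^ 'n::finite \<Rightarrow> real"
  assumes "continuous_on UNIV g"
  shows "set_integrable (\<Pi>\<^sub>M k\<in>J. lborel) (\<Pi>\<^sub>E k\<in>J. {a $ k .. b $ k}) (\<lambda>x. g (\<chi> k. x k))"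
proof -
  let ?M = "\<Pi>\<^sub>M k\<in>J. (lborel :: real measure)" and ?B = "\<Pi>\<^sub>E k\<in>J. {a $ k .. b $ k}"
  let ?l = "\<chi> k. if k \<in> J then a $ k else undefined"
  let ?u = "\<chi> k. if k \<in> J then b $ k else undefined"
  have "compact (g ` cbox ?l ?u)"
    by (rule compact_continuous_image[OF continuous_on_subset[OF assms subset_UNIV] compact_cbox])
  then have "bounded (g ` cbox ?l ?u)"
    by (rule compact_imp_bounded)
  then obtain C where C: "\<And>x. x \<in> cbox ?l ?u \<Longrightarrow> norm (g x) \<le> C"
    by (auto simp: bounded_iff)
  have "(\<chi> k. x k) \<in> cbox ?l ?u" if "x \<in> ?B" for x
    using that by (auto simp: mem_box_cart PiE_iff extensional_def)
  with C have bound: "norm (g (\<chi> k. x k)) \<le> C" if "x \<in> ?B" for x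
    using that by blast
  have meas: "(\<lambda>x. g (\<chi> k. x k)) \<in> borel_measurable ?M"
    using borel_measurable_continuous_onI[OF assms] vec_lambda_measurable
    by (rule measurable_compose_rev)
  have "emeasure ?M ?B < \<infinity>"
  proof -
    have "emeasure lborel {a $ k .. b $ k} = ennreal (max 0 (b $ k - a $ k))" for k
      by (simp add: emeasure_lborel_Icc_eq max_def)
    then have "emeasure ?M ?B = (\<Prod>k\<in>J. ennreal (max 0 (b $ k - a $ k)))"
      by (subst lebesgue_product.emeasure_PiM) auto
    also have "\<dots> = ennreal (\<Prod>k\<in>J. max 0 (b $ k - a $ k))"
      by (intro prod_ennreal) simp
    finally show ?thesis by simp
  qed
  then show ?thesis
    unfolding set_integrable_def
    using meas box_in_sets bound
    by (intro integrableI_bounded_set_indicator[where B = C]) (simp_all add: AE_I2)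
qed

lemma box_integral_add:
  assumes "continuous_on UNIV g" "continuous_on UNIV h"
  shows "box_integral J a b (\<lambda>x. g x + h x) = box_integral J a b g + box_integral J a b h"
  unfolding box_integral_def by (intro set_integral_add box_integrable assms)

lemma box_integral_diff:
  assumes "continuous_on UNIV g" "continuous_on UNIV h"
  shows "box_integral J a b (\<lambda>x. g x - h x) = box_integral J a b g - box_integral J a b h"
  unfolding box_integral_def by (intro set_integral_diff box_integrable assms)

lemma box_integral_cmult: "box_integral J a b (\<lambda>x. c * g x) = c * box_integral J a b g"
  unfolding box_integral_def by simp

lemma box_integral_minus: "box_integral J a b (\<lambda>x. - g x) = - box_integral J a b g"
  using box_integral_cmult[of J a b "-1" g] by simp

lemma box_integral_sum:
  assumes "\<And>i. i \<in> I \<Longrightarrow> continuous_on UNIV (g i)"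
  shows "box_integral J a b (\<lambda>x. \<Sum>i\<in>I. g i x) = (\<Sum>i\<in>I. box_integral J a b (g i))"
  using assms
proof (induction I rule: infinite_finite_induct)
  case (insert i I)
  then show ?case
    by (simp add: box_integral_add continuous_on_sum)
qed (simp_all add: box_integral_def)

lemma box_integral_UNIV:
  assumes "continuous_on UNIV g"
  shows "box_integral UNIV a b g = (LINT x : cbox a b | lborel. g x)"
proof -
  have meas: "(\<lambda>x. indicator (cbox a b) x *\<^sub>R g x) \<in> borel_measurable borel"
    using borel_measurable_continuous_onI[OF assms]
    by (intro borel_measurable_scaleR borel_measurable_indicator) auto
  have "(LINT x : cbox a b | lborel. g x) =
      (\<integral>x. indicator (cbox a b) (\<chi> k. x k) *\<^sub>R g (\<chi> k. x k) \<partial>(\<Pi>\<^sub>M k\<in>UNIV. lborel))"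
    unfolding set_lebesgue_integral_def
    by (subst lborel_eq_distr_PiM, rule integral_distr[OF vec_lambda_measurable meas])
  also have "\<dots> = box_integral UNIV a b g"
    unfolding box_integral_def set_lebesgue_integral_def
    by (intro Bochner_Integration.integral_cong)
      (auto simp: indicator_def mem_box_cart PiE_iff)
  finally show ?thesis ..
qed

lemma vec_upd_eq_add: "vec_upd x i c = x + (c - x $ i) *\<^sub>R axis i 1"
  by (simp add: vec_eq_iff axis_def)

lemma continuous_vec_upd [continuous_intros]:
  "continuous_on S f \<Longrightarrow> continuous_on S (\<lambda>x. vec_upd (f x) i c)"
  unfolding vec_upd_eq_add by (intro continuous_intros)

text \<open>
  Integration over the coordinate \<open>i\<close> first, by Fubini, and the fundamental theorem of calculus in that
  coordinate. This is the divergence theorem for a box; it is stated for every index set because the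
  off-diagonal second derivatives apply it twice, the second time on a face.
\<close>

lemma box_integral_partial_derivative:
  fixes g g' :: "real ^ 'n::finite \<Rightarrow> real"
  assumes "i \<in> J" and le: "a $ i \<le> b $ i"
    and g: "continuous_on UNIV g" and g': "continuous_on UNIV g'"
    and deriv: "\<And>x c. ((\<lambda>c. g (vec_upd x i c)) has_real_derivative g' (vec_upd x i c)) (at c)"
  shows "box_integral J a b g' =
    box_integral (J - {i}) a b (\<lambda>x. g (vec_upd x i (b $ i))) -
    box_integral (J - {i}) a b (\<lambda>x. g (vec_upd x i (a $ i)))"
proof -
  let ?K = "J - {i}"
  let ?h = "\<lambda>x. indicator (\<Pi>\<^sub>E k\<in>J. {a $ k .. b $ k}) x *\<^sub>R g' (\<chi> k. x k)"
  have J: "insert i ?K = J" using assms(1) by auto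
  have upd: "(\<chi> k. (x(i := c)) k) = vec_upd (\<chi> k. x k) i c" for x c
    by (simp add: vec_eq_iff)
  have int: "integrable (\<Pi>\<^sub>M k\<in>insert i ?K. lborel) ?h"
    using box_integrable[OF g', of J a b] unfolding J set_integrable_def .
  have "box_integral J a b g' = integral\<^sup>L (\<Pi>\<^sub>M k\<in>insert i ?K. lborel) ?h"
    unfolding J box_integral_def set_lebesgue_integral_def ..
  also have "\<dots> = (\<integral>x. (\<integral>c. ?h (x(i := c)) \<partial>lborel) \<partial>(\<Pi>\<^sub>M k\<in>?K. lborel))"
    by (rule lebesgue_product.product_integral_insert[OF _ _ int]) auto
  also have "\<dots> = (LINT x : (\<Pi>\<^sub>E k\<in>?K. {a $ k .. b $ k}) | (\<Pi>\<^sub>M k\<in>?K. lborel).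
      g (vec_upd (\<chi> k. x k) i (b $ i)) - g (vec_upd (\<chi> k. x k) i (a $ i)))"
    unfolding set_lebesgue_integral_def
  proof (intro Bochner_Integration.integral_cong refl)
    fix x assume "x \<in> space (\<Pi>\<^sub>M k\<in>?K. (lborel :: real measure))"
    then have ext: "x \<in> extensional ?K" by (auto simp: space_PiM PiE_def)
    let ?x = "\<chi> k. x k"
    have ind: "indicator (\<Pi>\<^sub>E k\<in>J. {a $ k .. b $ k}) (x(i := c)) =
        (indicator (\<Pi>\<^sub>E k\<in>?K. {a $ k .. b $ k}) x * indicator {a $ i .. b $ i} c :: real)" for c
      using ext assms(1) by (auto simp: indicator_def PiE_iff extensional_def split: if_splits)
    have cont: "continuous_on UNIV (\<lambda>c. g' (vec_upd ?x i c))"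
      unfolding vec_upd_eq_add by (intro continuous_intros continuous_on_compose2[OF g']) auto
    have "(\<integral>c. ?h (x(i := c)) \<partial>lborel) = indicator (\<Pi>\<^sub>E k\<in>?K. {a $ k .. b $ k}) x *
        (\<integral>c. indicator {a $ i .. b $ i} c *\<^sub>R g' (vec_upd ?x i c) \<partial>lborel)"
      unfolding ind upd by (simp add: mult.assoc)
    also have "(\<integral>c. indicator {a $ i .. b $ i} c *\<^sub>R g' (vec_upd ?x i c) \<partial>lborel) =
        g (vec_upd ?x i (b $ i)) - g (vec_upd ?x i (a $ i))"
      using deriv le continuous_on_subset[OF cont]
      by (intro integral_FTC_atLeastAtMost)
        (auto simp: has_real_derivative_iff_has_vector_derivative[symmetric]
          intro: has_vector_derivative_at_within has_field_derivative_at_within)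
    finally show "(\<integral>c. ?h (x(i := c)) \<partial>lborel) = indicator (\<Pi>\<^sub>E k\<in>?K. {a $ k .. b $ k}) x *\<^sub>R
        (g (vec_upd ?x i (b $ i)) - g (vec_upd ?x i (a $ i)))"
      by (simp only: real_scaleR_def)
  qed
  also have "\<dots> = box_integral ?K a b (\<lambda>x. g (vec_upd x i (b $ i))) -
      box_integral ?K a b (\<lambda>x. g (vec_upd x i (a $ i)))"
    unfolding box_integral_def
    by (intro set_integral_diff box_integrable continuous_on_compose2[OF g] continuous_intros) auto
  finally show ?thesis .
qed

section \<open>Differentiating the moment generating function of a bounded random vector\<close>

lemma exp_remainder_bound:
  fixes u :: real
  shows "\<bar>exp u - 1 - u\<bar> \<le> u\<^sup>2 * exp \<bar>u\<bar>"
proof -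
  obtain t where t: "\<bar>t\<bar> \<le> \<bar>u\<bar>" "exp u = (\<Sum>m<2. u ^ m / fact m) + exp t / fact 2 * u ^ 2"
    using Maclaurin_exp_le[of u 2] by blast
  then have "\<bar>exp u - 1 - u\<bar> = u\<^sup>2 * (exp t / 2)"
    by (simp add: numeral_2_eq_2 abs_mult)
  also have "\<dots> \<le> u\<^sup>2 * exp \<bar>u\<bar>"
  proof (intro mult_left_mono)
    have "exp t \<le> exp \<bar>u\<bar>" using t(1) by simp
    then show "exp t / 2 \<le> exp \<bar>u\<bar>" using exp_ge_zero[of "\<bar>u\<bar>"] by linarith
  qed simp
  finally show ?thesis .
qed

text \<open>
  Differentiation under the integral sign: for bounded \<open>X\<close> and \<open>Y\<close> the second-order remainder of the
  exponential is almost surely at most a fixed multiple of the squared norm of the increment. The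
  weight \<open>Y\<close> allows the lemma to be applied twice: \<open>Y = 1\<close> gives the gradient of the moment
  generating function, \<open>Y = X\<close> the derivative of that gradient.
\<close>

lemma (in prob_space) has_derivative_exp_moment:
  fixes X :: "'a \<Rightarrow> 'b::euclidean_space" and Y :: "'a \<Rightarrow> 'c::{banach, second_countable_topology}"
  assumes X: "X \<in> borel_measurable M" and Y: "Y \<in> borel_measurable M"
    and B: "0 \<le> B" "AE \<omega> in M. norm (X \<omega>) \<le> B"
    and C: "0 \<le> C" "AE \<omega> in M. norm (Y \<omega>) \<le> C"
  shows "((\<lambda>t. \<integral>\<omega>. exp (t \<bullet> X \<omega>) *\<^sub>R Y \<omega> \<partial>M) has_derivative
      (\<lambda>h. \<integral>\<omega>. ((h \<bullet> X \<omega>) * exp (t \<bullet> X \<omega>)) *\<^sub>R Y \<omega> \<partial>M)) (at t)"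
proof -
  note [measurable] = X Y
  define F where "F t \<omega> = exp (t \<bullet> X \<omega>) *\<^sub>R Y \<omega>" for t \<omega>
  define F' where "F' h \<omega> = ((h \<bullet> X \<omega>) * exp (t \<bullet> X \<omega>)) *\<^sub>R Y \<omega>" for h \<omega>
  have [measurable]: "F s \<in> borel_measurable M" "F' h \<in> borel_measurable M" for s h
    unfolding F_def F'_def by measurable
  have inner: "\<bar>h \<bullet> x\<bar> \<le> norm h * B" if "norm x \<le> B" for h x :: 'b
    using Cauchy_Schwarz_ineq2[of h x] that by (meson mult_left_mono norm_ge_zero order_trans)
  have exp: "exp (h \<bullet> x) \<le> exp (norm h * B)" if "norm x \<le> B" for h x :: 'b
    using inner[OF that, of h] by simp
  have bound: "norm (F s \<omega>) \<le> exp (norm s * B) * C" if "norm (X \<omega>) \<le> B" "norm (Y \<omega>) \<le> C" for s \<omega>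
    unfolding F_def using exp[OF that(1)] that(2) by (simp add: mult_mono)
  have bound': "norm (F' h \<omega>) \<le> norm h * (B * exp (norm t * B) * C)"
    if "norm (X \<omega>) \<le> B" "norm (Y \<omega>) \<le> C" for h \<omega>
  proof -
    have "norm (F' h \<omega>) \<le> (norm h * B) * exp (norm t * B) * C"
      unfolding F'_def using inner[OF that(1)] exp[OF that(1)] that(2) B(1) C(1)
      by (auto simp: abs_mult intro!: mult_mono)
    then show ?thesis by (simp add: mult_ac)
  qed
  have int: "integrable M (F s)" for s
    using B(2) C(2) by (intro integrable_const_bound[where B = "exp (norm s * B) * C"])
      (auto elim: eventually_elim2 intro: bound)
  have int': "integrable M (F' h)" for h
    using B(2) C(2) by (intro integrable_const_bound[where B = "norm h * (B * exp (norm t * B) * C)"])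
      (auto elim: eventually_elim2 intro: bound')
  have norm_le: "norm (integral\<^sup>L M f) \<le> K"
    if "f \<in> borel_measurable M" "AE \<omega> in M. norm (f \<omega>) \<le> K" for f :: "'a \<Rightarrow> 'c" and K
  proof -
    have "integrable M f"
      using that by (intro integrable_const_bound[where B = K])
    then have "(\<integral>\<omega>. norm (f \<omega>) \<partial>M) \<le> (\<integral>\<omega>. K \<partial>M)"
      using that by (intro integral_mono_AE) auto
    then show ?thesis
      by (intro order_trans[OF integral_norm_bound]) (simp add: prob_space)
  qed
  have "bounded_linear (\<lambda>h. integral\<^sup>L M (F' h))"
  proof (rule bounded_linear_intro)
    show "integral\<^sup>L M (F' (h + h')) = integral\<^sup>L M (F' h) + integral\<^sup>L M (F' h')" for h h'
      unfolding Bochner_Integration.integral_add[OF int' int', symmetric]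
      by (simp add: F'_def[abs_def] inner_add_left distrib_right scaleR_add_left)
    show "integral\<^sup>L M (F' (r *\<^sub>R h)) = r *\<^sub>R integral\<^sup>L M (F' h)" for r h
      unfolding integral_scaleR_right[symmetric] by (simp add: F'_def[abs_def] mult.assoc)
    show "norm (integral\<^sup>L M (F' h)) \<le> norm h * (B * exp (norm t * B) * C)" for h
      using B(2) C(2) by (intro norm_le) (auto elim: eventually_elim2 intro: bound')
  qed
  moreover have "(\<lambda>h. norm (integral\<^sup>L M (F (t + h)) - integral\<^sup>L M (F t) - integral\<^sup>L M (F' h)) / norm h)
      \<midarrow>0\<rightarrow> 0"
  proof (rule Lim_null_comparison)
    define K where "K = exp (norm t * B) * (B\<^sup>2 * exp B) * C"
    have K: "0 \<le> K" using B(1) C(1) by (simp add: K_def)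
    have rem: "norm (integral\<^sup>L M (F (t + h)) - integral\<^sup>L M (F t) - integral\<^sup>L M (F' h)) \<le> (norm h)\<^sup>2 * K"
      if h: "norm h \<le> 1" for h
    proof -
      have pw: "norm (F (t + h) \<omega> - F t \<omega> - F' h \<omega>) \<le> (norm h)\<^sup>2 * K"
        if "norm (X \<omega>) \<le> B" "norm (Y \<omega>) \<le> C" for \<omega>
      proof -
        let ?u = "h \<bullet> X \<omega>"
        have u: "\<bar>?u\<bar> \<le> norm h * B" by (rule inner[OF that(1)])
        also have "norm h * B \<le> 1 * B" using h B(1) by (rule mult_right_mono)
        finally have u': "\<bar>?u\<bar> \<le> B" by simp
        have "F (t + h) \<omega> - F t \<omega> - F' h \<omega> = (exp (t \<bullet> X \<omega>) * (exp ?u - 1 - ?u)) *\<^sub>R Y \<omega>"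
          by (simp add: F_def F'_def inner_add_left exp_add algebra_simps)
        then have "norm (F (t + h) \<omega> - F t \<omega> - F' h \<omega>) =
            exp (t \<bullet> X \<omega>) * \<bar>exp ?u - 1 - ?u\<bar> * norm (Y \<omega>)"
          by (simp add: abs_mult)
        also have "\<dots> \<le> exp (norm t * B) * ((norm h * B)\<^sup>2 * exp B) * C"
        proof (intro mult_mono exp that)
          have "\<bar>exp ?u - 1 - ?u\<bar> \<le> ?u\<^sup>2 * exp \<bar>?u\<bar>" by (rule exp_remainder_bound)
          also have "\<dots> \<le> (norm h * B)\<^sup>2 * exp B"
            using u u' by (intro mult_mono) (auto simp: abs_le_square_iff[symmetric])
          finally show "\<bar>exp ?u - 1 - ?u\<bar> \<le> (norm h * B)\<^sup>2 * exp B" .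
        qed (use B(1) C(1) in auto)
        also have "\<dots> = (norm h)\<^sup>2 * K" by (simp add: K_def power_mult_distrib mult_ac)
        finally show ?thesis .
      qed
      have "integral\<^sup>L M (F (t + h)) - integral\<^sup>L M (F t) - integral\<^sup>L M (F' h) =
          (\<integral>\<omega>. F (t + h) \<omega> - F t \<omega> - F' h \<omega> \<partial>M)"
        using int int' by simp
      moreover have "norm (\<integral>\<omega>. F (t + h) \<omega> - F t \<omega> - F' h \<omega> \<partial>M) \<le> (norm h)\<^sup>2 * K"
        using B(2) C(2) by (intro norm_le) (auto elim: eventually_elim2 intro: pw)
      ultimately show ?thesis by simp
    qed
    have "\<forall>\<^sub>F h in at (0 :: 'b). norm h < 1"
      using eventually_at_ball[of 1 "0 :: 'b" UNIV] by (auto elim!: eventually_mono)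
    then show "\<forall>\<^sub>F h in at 0. norm (norm (integral\<^sup>L M (F (t + h)) - integral\<^sup>L M (F t) - integral\<^sup>L M (F' h)) / norm h)
        \<le> norm h * K"
    proof eventually_elim
      case (elim h)
      then have "norm (integral\<^sup>L M (F (t + h)) - integral\<^sup>L M (F t) - integral\<^sup>L M (F' h)) \<le> (norm h * K) * norm h"
        using rem[of h] by (simp add: power2_eq_square mult_ac)
      then show ?case
        using K by (cases "h = 0") (auto simp: divide_le_eq)
    qed
    show "((\<lambda>h. norm h * K) \<longlongrightarrow> 0) (at (0::'b))"
      by (auto intro!: tendsto_eq_intros)
  qed
  ultimately show ?thesis
    unfolding has_derivative_at F_def F'_def by simp
qed

lemma outer_nth [simp]: "outer x y $ i $ j = x $ i * y $ j"
  by (simp add: outer_def matrix_matrix_mult_def columnvector_def rowvector_def)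

lemma outer_mult_vec: "outer x y *v h = (h \<bullet> y) *\<^sub>R x"
  by (simp add: vec_eq_iff matrix_vector_mult_def inner_vec_def sum_distrib_left mult_ac)

lemma continuous_on_outer [continuous_intros]:
  assumes "continuous_on S f" "continuous_on S g"
  shows "continuous_on S (\<lambda>x. outer (f x) (g x))"
proof -
  have "outer x y = (\<chi> i j. x $ i * y $ j)" for x y :: "real ^ 'b"
    by (simp add: vec_eq_iff)
  with assms show ?thesis
    by (simp only:) (intro continuous_intros)
qed

lemma (in prob_space) integrable_continuous_bounded:
  fixes X :: "'a \<Rightarrow> 'b::euclidean_space" and g :: "'b \<Rightarrow> 'c::{banach, second_countable_topology}"
  assumes X: "X \<in> borel_measurable M" and B: "AE \<omega> in M. norm (X \<omega>) \<le> B"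
    and g: "continuous_on UNIV g"
  shows "integrable M (\<lambda>\<omega>. g (X \<omega>))"
proof -
  have "compact (g ` cball 0 B)"
    by (rule compact_continuous_image[OF continuous_on_subset[OF g subset_UNIV] compact_cball])
  then have "bounded (g ` cball 0 B)"
    by (rule compact_imp_bounded)
  then obtain C where C: "\<And>x. norm x \<le> B \<Longrightarrow> norm (g x) \<le> C"
    by (metis bounded_iff imageI mem_cball_0)
  have "(\<lambda>\<omega>. g (X \<omega>)) \<in> borel_measurable M"
    using borel_measurable_continuous_onI[OF g] X by (rule measurable_compose_rev)
  with B show ?thesis
    by (intro integrable_const_bound[where B = C]) (auto elim!: eventually_mono intro: C)
qed

lemma (in prob_space) mgf_derivatives:
  fixes X :: "'a \<Rightarrow> real ^ 'n::finite"
  assumes X: "X \<in> borel_measurable M" and B: "0 \<le> B" "AE \<omega> in M. norm (X \<omega>) \<le> B"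
  shows "GDERIV (mgf M X) 0 :> mean_vec M X"
    and "has_hessian (mgf M X) (second_moment M X) 0"
proof -
  define G where "G s = (\<integral>\<omega>. exp (s \<bullet> X \<omega>) *\<^sub>R X \<omega> \<partial>M)" for s
  have grad: "GDERIV (mgf M X) s :> G s" for s
  proof -
    have "continuous_on UNIV (\<lambda>x :: real ^ 'n. exp (s \<bullet> x) *\<^sub>R x)"
      by (intro continuous_intros)
    from integrable_continuous_bounded[OF X B(2) this]
    have "integrable M (\<lambda>\<omega>. exp (s \<bullet> X \<omega>) *\<^sub>R X \<omega>)" .
    then have "h \<bullet> G s = (\<integral>\<omega>. ((h \<bullet> X \<omega>) * exp (s \<bullet> X \<omega>)) *\<^sub>R 1 \<partial>M)" for h
      unfolding G_def by (subst integral_inner_right[symmetric]) (simp_all add: mult.commute)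
    then show ?thesis
      using has_derivative_exp_moment[OF X, of "\<lambda>_. 1 :: real" B 1 s] B
      by (simp add: gderiv_def mgf_def[abs_def])
  qed
  have "G 0 = mean_vec M X"
    by (simp add: G_def mean_vec_def)
  with grad[of 0] show "GDERIV (mgf M X) 0 :> mean_vec M X" by simp
  have "continuous_on UNIV (\<lambda>x :: real ^ 'n. outer x x)"
    by (intro continuous_intros)
  from integrable_continuous_bounded[OF X B(2) this]
  have int: "integrable M (\<lambda>\<omega>. outer (X \<omega>) (X \<omega>))" .
  have "second_moment M X *v h = (\<integral>\<omega>. (h \<bullet> X \<omega>) *\<^sub>R X \<omega> \<partial>M)" for h
  proof -
    have "linear (\<lambda>A :: real ^ 'n ^ 'n. A *v h)"
      by (simp add: linear_iff matrix_vector_mult_add_rdistrib scaleR_matrix_vector_assoc)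
    then have "bounded_linear (\<lambda>A :: real ^ 'n ^ 'n. A *v h)"
      by (simp add: linear_conv_bounded_linear)
    from integral_bounded_linear[OF this int] show ?thesis
      by (simp add: second_moment_def outer_mult_vec)
  qed
  then have "(G has_derivative (\<lambda>h. second_moment M X *v h)) (at 0)"
    using has_derivative_exp_moment[OF X X B B, of 0] by (simp add: G_def[abs_def])
  then show "has_hessian (mgf M X) (second_moment M X) 0"
    unfolding has_hessian_def using grad by (intro exI[of _ G]) auto
qed

section \<open>Derivatives of the normal density\<close>

text \<open>
  The first and second partial derivatives of the centred normal density in closed form, so that the
  identities with \<open>R\<close> below are pure algebra; that these are the derivatives is shown in
  \<open>normal_density_partial_deriv\<close> and \<open>normal_partial_deriv\<close>.
\<close>

definition normal_partial :: "real ^ 'n::finite ^ 'n \<Rightarrow> 'n \<Rightarrow> real ^ 'n \<Rightarrow> real" where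
  "normal_partial R k x = - (matrix_inv R *v x) $ k * mvn_density UNIV 0 R x"

definition normal_partial2 :: "real ^ 'n::finite ^ 'n \<Rightarrow> 'n \<Rightarrow> 'n \<Rightarrow> real ^ 'n \<Rightarrow> real" where
  "normal_partial2 R k l x =
     ((matrix_inv R *v x) $ k * (matrix_inv R *v x) $ l - matrix_inv R $ k $ l)
       * mvn_density UNIV 0 R x"

lemma vec_upd_nth_deriv:
  "((\<lambda>c. vec_upd x i c $ k) has_real_derivative (if k = i then 1 else 0)) (at c)"
  by (cases "k = i") (auto intro!: derivative_eq_intros)

lemma matrix_vec_upd_deriv:
  fixes P :: "real ^ 'n::finite ^ 'n"
  shows "((\<lambda>c. (P *v vec_upd x i c) $ k) has_real_derivative P $ k $ i) (at c)"
proof -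
  have "(P *v vec_upd x i c) $ k = (P *v x) $ k + (c - x $ i) * P $ k $ i" for c
    by (simp add: vec_upd_eq_add matrix_vector_right_distrib matrix_vector_mult_scaleR
        matrix_vector_mult_basis column_def)
  then show ?thesis
    by (auto intro!: derivative_eq_intros)
qed

lemma normal_density_partial_deriv:
  fixes R :: "real ^ 'n::finite ^ 'n"
  assumes sym: "transpose (matrix_inv R) = matrix_inv R"
  shows "((\<lambda>c. mvn_density UNIV 0 R (vec_upd x i c)) has_real_derivative
    normal_partial R i (vec_upd x i c)) (at c)"
proof -
  let ?P = "matrix_inv R" and ?y = "vec_upd x i"
  have Pt: "?P $ k $ i = ?P $ i $ k" for k
    using arg_cong[OF sym, of "\<lambda>M. M $ k $ i"] by (simp add: transpose_def)
  have "((\<lambda>c. \<Sum>k\<in>UNIV. ?y c $ k * (?P *v ?y c) $ k) has_real_derivative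
      (\<Sum>k\<in>UNIV. (if k = i then 1 else 0) * (?P *v ?y c) $ k + ?P $ k $ i * ?y c $ k)) (at c)"
    by (intro DERIV_sum DERIV_mult vec_upd_nth_deriv matrix_vec_upd_deriv)
  also have "(\<Sum>k\<in>UNIV. (if k = i then 1 else 0) * (?P *v ?y c) $ k + ?P $ k $ i * ?y c $ k) =
      (?P *v ?y c) $ i + (\<Sum>k\<in>UNIV. ?P $ k $ i * ?y c $ k)"
    by (simp add: sum.distrib if_distrib[where f = "\<lambda>u. u * _"] cong: if_cong)
  also have "(\<Sum>k\<in>UNIV. ?P $ k $ i * ?y c $ k) = (?P *v ?y c) $ i"
    unfolding matrix_vector_mult_def vec_lambda_beta by (intro sum.cong refl arg_cong2[where f = "(*)"] Pt)
  finally have q: "((\<lambda>c. ?y c \<bullet> (?P *v ?y c)) has_real_derivative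
      (?P *v ?y c) $ i + (?P *v ?y c) $ i) (at c)"
    unfolding inner_vec_def inner_real_def .
  show ?thesis
    unfolding mvn_density_def normal_partial_def inv_on_UNIV diff_zero
    by (rule DERIV_cong[OF DERIV_cdivide[OF DERIV_fun_exp[OF DERIV_cdivide[OF DERIV_minus[OF q]]]]])
      (simp add: field_simps)
qed

lemma normal_partial_deriv:
  fixes R :: "real ^ 'n::finite ^ 'n"
  assumes sym: "transpose (matrix_inv R) = matrix_inv R"
  shows "((\<lambda>c. normal_partial R k (vec_upd x i c)) has_real_derivative
    normal_partial2 R k i (vec_upd x i c)) (at c)"
  unfolding normal_partial_def
  by (rule DERIV_cong[OF DERIV_mult[OF DERIV_minus[OF matrix_vec_upd_deriv]
          normal_density_partial_deriv[OF sym]]])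
    (simp add: normal_partial_def normal_partial2_def algebra_simps)

lemma continuous_matrix_vector_mult [continuous_intros]:
  fixes A :: "real ^ 'n::finite ^ 'm::finite"
  shows "continuous_on S f \<Longrightarrow> continuous_on S (\<lambda>x. A *v f x)"
  by (rule bounded_linear.continuous_on[OF matrix_vector_mul_bounded_linear])

lemma continuous_mvn_density [continuous_intros]:
  "continuous_on S f \<Longrightarrow> continuous_on S (\<lambda>x. mvn_density J \<mu> R (f x))"
  unfolding mvn_density_def divide_inverse by (intro continuous_intros)

lemma continuous_normal_partial [continuous_intros]:
  "continuous_on S f \<Longrightarrow> continuous_on S (\<lambda>x. normal_partial R k (f x))"
  unfolding normal_partial_def by (intro continuous_intros)

lemma continuous_normal_partial2 [continuous_intros]:
  "continuous_on S f \<Longrightarrow> continuous_on S (\<lambda>x. normal_partial2 R k l (f x))"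
  unfolding normal_partial2_def by (intro continuous_intros)

lemma vec_upd_commute: "k \<noteq> l \<Longrightarrow> vec_upd (vec_upd x k c) l d = vec_upd (vec_upd x l d) k c"
  by (simp add: vec_eq_iff)

locale pos_def_correlation =
  fixes R :: "real ^ 'n::finite ^ 'n"
  assumes sym: "transpose R = R" and diag: "\<And>i. R $ i $ i = 1"
    and pos_def: "\<And>x. x \<noteq> 0 \<Longrightarrow> 0 < x \<bullet> (R *v x)"
begin

lemma det_pos: "0 < det R"
  by (rule det_pos_def[OF pos_def])

lemma R_inv: "R ** matrix_inv R = mat 1" "matrix_inv R ** R = mat 1"
proof -
  obtain B where B: "R ** B = mat 1" "B ** R = mat 1"
    using det_pos invertible_det_nz[of R] by (auto simp: invertible_def)
  then show "R ** matrix_inv R = mat 1" "matrix_inv R ** R = mat 1"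
    by (simp_all add: matrix_inv_eq)
qed

lemma density_pos: "0 < mvn_density UNIV 0 R x"
  using det_pos by (simp add: mvn_density_def det_on_UNIV)

lemma sym_nth: "R $ i $ j = R $ j $ i"
  using arg_cong[OF sym, of "\<lambda>M. M $ j $ i"] by (simp add: transpose_def)

lemma sym_inv: "transpose (matrix_inv R) = matrix_inv R"
  using transpose_matrix_inv[of R] det_pos by (simp add: invertible_det_nz sym)

lemma normal_partial2_commute: "normal_partial2 R k l = normal_partial2 R l k"
proof -
  have "matrix_inv R $ k $ l = matrix_inv R $ l $ k"
    using arg_cong[OF sym_inv, of "\<lambda>M. M $ l $ k"] by (simp add: transpose_def)
  then show ?thesis by (simp add: normal_partial2_def fun_eq_iff)
qed

lemma sum_R_inv: "(\<Sum>k\<in>UNIV. R $ i $ k * (matrix_inv R *v x) $ k) = x $ i"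
proof -
  have "(\<Sum>k\<in>UNIV. R $ i $ k * (matrix_inv R *v x) $ k) = (R *v (matrix_inv R *v x)) $ i"
    by (simp add: matrix_vector_mult_def)
  then show ?thesis by (simp add: matrix_vector_mul_assoc R_inv)
qed

text \<open>
  The two identities behind the theorem: with the gradient \<open>- inverse R *v x\<close> of the logarithm of the
  density, multiplication by \<open>R\<close> trades one derivative for a coordinate of \<open>x\<close>.
\<close>

lemma sum_R_partial: "(\<Sum>k\<in>UNIV. R $ i $ k * normal_partial R k x) = - x $ i * mvn_density UNIV 0 R x"
  using sum_R_inv[of i x]
  by (simp add: normal_partial_def sum_negf flip: mult.assoc sum_distrib_right)

lemma sum_R_partial2:
  "(\<Sum>k\<in>UNIV. R $ i $ k * normal_partial2 R k l x) =
    - x $ i * normal_partial R l x - (if i = l then mvn_density UNIV 0 R x else 0)"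
proof -
  have inv_nth: "(\<Sum>k\<in>UNIV. R $ i $ k * matrix_inv R $ k $ l) = (if i = l then 1 else 0)"
    using arg_cong[OF R_inv(1), of "\<lambda>M. M $ i $ l"]
    by (simp add: matrix_matrix_mult_def mat_def)
  have "(\<Sum>k\<in>UNIV. R $ i $ k * normal_partial2 R k l x) =
      ((\<Sum>k\<in>UNIV. R $ i $ k * (matrix_inv R *v x) $ k) * (matrix_inv R *v x) $ l
        - (\<Sum>k\<in>UNIV. R $ i $ k * matrix_inv R $ k $ l)) * mvn_density UNIV 0 R x"
    unfolding normal_partial2_def sum_distrib_right sum_subtractf[symmetric]
    by (intro sum.cong refl) (simp add: algebra_simps)
  also have "\<dots> = - x $ i * normal_partial R l x - (if i = l then mvn_density UNIV 0 R x else 0)"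
    unfolding sum_R_inv inv_nth by (simp add: normal_partial_def algebra_simps)
  finally show ?thesis .
qed

lemma box_integral_face:
  "box_integral (- {i}) a b (\<lambda>x. mvn_density UNIV 0 R (vec_upd x i c)) = face_term R a b i c"
  using det_pos
  by (simp add: mvn_density_face[OF sym diag] box_integral_cmult face_term_def mvn_box_eq)

lemma box_integral_edge:
  assumes "i \<noteq> j"
  shows "box_integral (- {i, j}) a b (\<lambda>x. mvn_density UNIV 0 R (vec_upd (vec_upd x i c) j d)) =
    edge_term R a b i j c d"
  using det_pos det_on_pos_def[OF pos_def, of "{i, j}"] assms
  by (simp add: mvn_density_edge[OF sym diag diag] box_integral_cmult edge_term_def mvn_box_eq)

end

section \<open>Integrals of the density and its derivatives over a box\<close>

locale correlation_box = pos_def_correlation R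
  for R :: "real ^ 'n::finite ^ 'n" +
  fixes a b :: "real ^ 'n"
  assumes box: "\<And>i. a $ i < b $ i"
begin

text \<open>
  The fundamental theorem gives the value at \<open>b\<close> minus the value at \<open>a\<close>, the opposite of the order in
  \<open>q\<close>; this sign cancels the one in \<open>sum_R_partial\<close>, so the mean of the truncated law is
  \<open>R *v q / L\<close> with a positive sign.
\<close>

lemma box_integral_partial:
  "box_integral UNIV a b (normal_partial R k) = - q_vec R a b $ k"
proof -
  have "box_integral UNIV a b (normal_partial R k) =
      box_integral (UNIV - {k}) a b (\<lambda>x. mvn_density UNIV 0 R (vec_upd x k (b $ k))) -
      box_integral (UNIV - {k}) a b (\<lambda>x. mvn_density UNIV 0 R (vec_upd x k (a $ k)))"
    by (rule box_integral_partial_derivative)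
      (use box in \<open>auto intro!: continuous_intros normal_density_partial_deriv sym_inv less_imp_le\<close>)
  then show ?thesis
    by (simp add: box_integral_face q_vec_def flip: Compl_eq_Diff_UNIV)
qed

lemma box_integral_partial2_off_diag:
  assumes kl: "k \<noteq> l"
  shows "box_integral UNIV a b (normal_partial2 R k l) = h_off R a b k l"
proof -
  have inner: "box_integral (- {l}) a b (\<lambda>x. normal_partial R k (vec_upd x l d)) =
      edge_term R a b k l (b $ k) d - edge_term R a b k l (a $ k) d" for d
  proof -
    have "box_integral (- {l}) a b (\<lambda>x. normal_partial R k (vec_upd x l d)) =
        box_integral (- {l} - {k}) a b (\<lambda>x. mvn_density UNIV 0 R (vec_upd (vec_upd x k (b $ k)) l d)) -
        box_integral (- {l} - {k}) a b (\<lambda>x. mvn_density UNIV 0 R (vec_upd (vec_upd x k (a $ k)) l d))"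
      by (rule box_integral_partial_derivative)
        (use box kl in \<open>auto intro!: continuous_intros normal_density_partial_deriv sym_inv
          less_imp_le simp: vec_upd_commute[of k l]\<close>)
    moreover have "- {l} - {k} = - {k, l}" by auto
    ultimately show ?thesis by (simp add: box_integral_edge kl)
  qed
  have "box_integral UNIV a b (normal_partial2 R k l) =
      box_integral (UNIV - {l}) a b (\<lambda>x. normal_partial R k (vec_upd x l (b $ l))) -
      box_integral (UNIV - {l}) a b (\<lambda>x. normal_partial R k (vec_upd x l (a $ l)))"
    by (rule box_integral_partial_derivative)
      (use box in \<open>auto intro!: continuous_intros normal_partial_deriv sym_inv less_imp_le\<close>)
  then show ?thesis
    by (simp add: inner h_off_def flip: Compl_eq_Diff_UNIV)
qed

text \<open>
  For \<open>k = l\<close> the fundamental theorem would produce boundary integrals of a first derivative, which are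
  not face terms. Instead, \<open>sum_R_partial2\<close> with \<open>i = l = k\<close> and \<open>R $ k $ k = 1\<close> expresses the
  pure second derivative through the mixed ones and \<open>- \<partial>\<^sub>k (x $ k * f x)\<close>, where \<open>f\<close> is the density; the
  boundary integrals of \<open>x $ k * f x\<close> are multiples of face terms, since \<open>x $ k\<close> is constant on a face.
\<close>

lemma box_integral_partial2:
  "box_integral UNIV a b (normal_partial2 R k l) = H_mat R a b $ k $ l"
proof (cases "k = l")
  case False
  then show ?thesis by (simp add: box_integral_partial2_off_diag H_mat_def)
next
  case True
  let ?f = "mvn_density UNIV 0 R"
  let ?g = "\<lambda>x. x $ k * ?f x" and ?g' = "\<lambda>x. ?f x + x $ k * normal_partial R k x"
  have "box_integral UNIV a b ?g' =
      box_integral (UNIV - {k}) a b (\<lambda>x. ?g (vec_upd x k (b $ k))) -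
      box_integral (UNIV - {k}) a b (\<lambda>x. ?g (vec_upd x k (a $ k)))"
  proof (rule box_integral_partial_derivative)
    show "((\<lambda>c. ?g (vec_upd x k c)) has_real_derivative ?g' (vec_upd x k c)) (at c)" for x c
      by (rule DERIV_cong[OF DERIV_mult[OF vec_upd_nth_deriv normal_density_partial_deriv[OF sym_inv]]])
        simp
  qed (use box in \<open>auto intro!: continuous_intros less_imp_le\<close>)
  then have g': "box_integral UNIV a b ?g' =
      b $ k * face_term R a b k (b $ k) - a $ k * face_term R a b k (a $ k)"
    by (simp add: box_integral_cmult box_integral_face flip: Compl_eq_Diff_UNIV)
  have eq: "normal_partial2 R k k = (\<lambda>x. - ?g' x - (\<Sum>m\<in>- {k}. R $ k $ m * normal_partial2 R m k x))"
  proof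
    fix x
    have "(\<Sum>m\<in>UNIV. R $ k $ m * normal_partial2 R m k x) =
        normal_partial2 R k k x + (\<Sum>m\<in>- {k}. R $ k $ m * normal_partial2 R m k x)"
      by (subst sum.remove[of UNIV k]) (simp_all add: diag Compl_eq_Diff_UNIV)
    then show "normal_partial2 R k k x = - ?g' x - (\<Sum>m\<in>- {k}. R $ k $ m * normal_partial2 R m k x)"
      unfolding sum_R_partial2 by simp
  qed
  have "box_integral UNIV a b (normal_partial2 R k k) =
      - box_integral UNIV a b ?g' - (\<Sum>m\<in>- {k}. R $ k $ m * box_integral UNIV a b (normal_partial2 R m k))"
  proof -
    have "box_integral UNIV a b (normal_partial2 R k k) = box_integral UNIV a b (\<lambda>x. - ?g' x) -
        box_integral UNIV a b (\<lambda>x. \<Sum>m\<in>- {k}. R $ k $ m * normal_partial2 R m k x)"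
      by (subst eq, rule box_integral_diff) (intro continuous_intros)+
    also have "box_integral UNIV a b (\<lambda>x. - ?g' x) = - box_integral UNIV a b ?g'"
      by (rule box_integral_minus)
    also have "box_integral UNIV a b (\<lambda>x. \<Sum>m\<in>- {k}. R $ k $ m * normal_partial2 R m k x) =
        (\<Sum>m\<in>- {k}. R $ k $ m * box_integral UNIV a b (normal_partial2 R m k))"
      by (subst box_integral_sum) (simp_all add: box_integral_cmult continuous_intros)
    finally show ?thesis .
  qed
  also have "(\<Sum>m\<in>- {k}. R $ k $ m * box_integral UNIV a b (normal_partial2 R m k)) =
      (\<Sum>m\<in>- {k}. R $ k $ m * h_off R a b m k)"
    by (intro sum.cong) (auto simp: box_integral_partial2_off_diag)
  finally show ?thesis
    unfolding g' using True by (simp add: H_mat_def)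
qed

text \<open>
  The entries of \<open>H\<close> are integrals of second partial derivatives, which commute.
\<close>

lemma H_mat_symmetric: "transpose (H_mat R a b) = H_mat R a b"
  by (simp add: vec_eq_iff transpose_def flip: box_integral_partial2)
    (metis normal_partial2_commute)

lemma box_integral_first_moment:
  "box_integral UNIV a b (\<lambda>x. x $ i * mvn_density UNIV 0 R x) = (R *v q_vec R a b) $ i"
proof -
  have "(\<lambda>x. x $ i * mvn_density UNIV 0 R x) = (\<lambda>x. - (\<Sum>k\<in>UNIV. R $ i $ k * normal_partial R k x))"
    by (simp add: sum_R_partial)
  then show ?thesis
    by (simp add: box_integral_minus box_integral_sum box_integral_cmult box_integral_partial
        continuous_intros matrix_vector_mult_def sum_negf)
qed

text \<open>
  Two applications of \<open>R\<close> to the Hessian of the density, one on each side, give \<open>outer x x - R\<close> times the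
  density.
\<close>

lemma box_integral_second_moment:
  "box_integral UNIV a b (\<lambda>x. x $ i * x $ j * mvn_density UNIV 0 R x) =
    R $ i $ j * mvn_box UNIV a b 0 R + (R ** H_mat R a b ** R) $ i $ j"
proof -
  let ?f = "mvn_density UNIV 0 R"
  have eq: "(\<Sum>l\<in>UNIV. (\<Sum>k\<in>UNIV. R $ i $ k * normal_partial2 R k l x) * R $ l $ j) =
      x $ i * x $ j * ?f x - R $ i $ j * ?f x" for x
  proof -
    have "(\<Sum>l\<in>UNIV. (\<Sum>k\<in>UNIV. R $ i $ k * normal_partial2 R k l x) * R $ l $ j) =
        (\<Sum>l\<in>UNIV. - x $ i * (R $ j $ l * normal_partial R l x) - (if i = l then R $ i $ j * ?f x else 0))"
    proof (intro sum.cong refl)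
      fix l
      show "(\<Sum>k\<in>UNIV. R $ i $ k * normal_partial2 R k l x) * R $ l $ j =
          - x $ i * (R $ j $ l * normal_partial R l x) - (if i = l then R $ i $ j * ?f x else 0)"
        unfolding sum_R_partial2 sym_nth[of j l] by (simp add: algebra_simps)
    qed
    also have "\<dots> = - x $ i * (\<Sum>l\<in>UNIV. R $ j $ l * normal_partial R l x) - R $ i $ j * ?f x"
      by (simp add: sum_subtractf sum_negf sum_distrib_left)
    finally show ?thesis by (simp add: sum_R_partial)
  qed
  have "(\<lambda>x. x $ i * x $ j * ?f x) = (\<lambda>x. R $ i $ j * ?f x +
      (\<Sum>l\<in>UNIV. \<Sum>k\<in>UNIV. (R $ i $ k * R $ l $ j) * normal_partial2 R k l x))"
  proof
    fix x
    have "(\<Sum>l\<in>UNIV. \<Sum>k\<in>UNIV. (R $ i $ k * R $ l $ j) * normal_partial2 R k l x) =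
        (\<Sum>l\<in>UNIV. (\<Sum>k\<in>UNIV. R $ i $ k * normal_partial2 R k l x) * R $ l $ j)"
      unfolding sum_distrib_right by (intro sum.cong refl) (simp only: mult_ac)
    then show "x $ i * x $ j * ?f x = R $ i $ j * ?f x +
        (\<Sum>l\<in>UNIV. \<Sum>k\<in>UNIV. (R $ i $ k * R $ l $ j) * normal_partial2 R k l x)"
      unfolding eq by simp
  qed
  then have "box_integral UNIV a b (\<lambda>x. x $ i * x $ j * ?f x) = R $ i $ j * box_integral UNIV a b ?f +
      (\<Sum>l\<in>UNIV. \<Sum>k\<in>UNIV. (R $ i $ k * R $ l $ j) * H_mat R a b $ k $ l)"
    by (simp add: box_integral_add box_integral_sum box_integral_cmult box_integral_partial2
        continuous_intros)
  moreover have "(\<Sum>l\<in>UNIV. \<Sum>k\<in>UNIV. (R $ i $ k * R $ l $ j) * H_mat R a b $ k $ l) =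
      (R ** H_mat R a b ** R) $ i $ j"
    unfolding matrix_matrix_mult_def vec_lambda_beta sum_distrib_right
    by (intro sum.cong refl) (simp only: mult_ac)
  ultimately show ?thesis
    by (simp add: mvn_box_eq)
qed

lemma box_probability_pos: "0 < mvn_box UNIV a b 0 R"
proof -
  let ?f = "mvn_density UNIV 0 R"
  have cont: "continuous_on UNIV ?f" by (intro continuous_intros)
  have ne: "cbox a b \<noteq> {}"
    using box by (auto simp: interval_ne_empty_cart less_imp_le)
  obtain z where z: "\<And>x. x \<in> cbox a b \<Longrightarrow> ?f z \<le> ?f x"
    using continuous_attains_inf[OF compact_cbox ne continuous_on_subset[OF cont subset_UNIV]]
    by blast
  have fin: "emeasure lborel (cbox a b) < \<infinity>"
    by (simp add: emeasure_lborel_cbox_eq)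
  have "0 < ?f z * measure lborel (cbox a b)"
  proof -
    have "0 < measure lborel (cbox a b)"
      using box by (intro content_pos_lt) (auto simp: Basis_vec_def inner_axis)
    with density_pos[of z] show ?thesis by simp
  qed
  also have "\<dots> = (LINT x : cbox a b | lborel. ?f z)"
    using fin by (simp add: set_lebesgue_integral_def)
  also have "\<dots> \<le> (LINT x : cbox a b | lborel. ?f x)"
  proof (rule set_integral_mono)
    show "set_integrable lborel (cbox a b) ?f"
      unfolding set_integrable_def
      by (rule borel_integrable_compact[OF compact_cbox continuous_on_subset[OF cont subset_UNIV]])
    show "set_integrable lborel (cbox a b) (\<lambda>x. ?f z)"
      unfolding set_integrable_def
      by (rule borel_integrable_compact[OF compact_cbox continuous_on_const])
  qed (use z in auto)
  also have "\<dots> = mvn_box UNIV a b 0 R"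
    by (simp add: mvn_box_eq box_integral_UNIV[OF cont])
  finally show ?thesis .
qed

lemma truncated_mvn_eq_density:
  "truncated_mvn 0 R a b = density lborel (\<lambda>x. ennreal
     (indicator (cbox a b) x * mvn_density UNIV 0 R x / mvn_box UNIV a b 0 R))"
proof -
  let ?f = "mvn_density UNIV 0 R" and ?L = "mvn_box UNIV a b 0 R"
  have cont: "continuous_on UNIV ?f" by (intro continuous_intros)
  have meas [measurable]: "?f \<in> borel_measurable borel"
    by (rule borel_measurable_continuous_onI[OF cont])
  have nonneg: "0 \<le> ?f x" for x
    using density_pos[of x] by simp
  have S: "{x. \<forall>k. a $ k \<le> x $ k \<and> x $ k \<le> b $ k} = cbox a b"
    by (auto simp: mem_box_cart)
  have "emeasure (mvn 0 R) (cbox a b) = (\<integral>\<^sup>+x. ennreal (indicator (cbox a b) x * ?f x) \<partial>lborel)"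
    unfolding mvn_def
    by (subst emeasure_density) (auto intro!: nn_integral_cong simp: indicator_def)
  also have "\<dots> = ennreal (\<integral>x. indicator (cbox a b) x * ?f x \<partial>lborel)"
  proof (rule nn_integral_eq_integral)
    have "set_integrable lborel (cbox a b) ?f"
      unfolding set_integrable_def
      by (rule borel_integrable_compact[OF compact_cbox continuous_on_subset[OF cont subset_UNIV]])
    then show "integrable lborel (\<lambda>x. indicator (cbox a b) x * ?f x)"
      by (simp add: set_integrable_def)
  qed (simp add: nonneg)
  also have "(\<integral>x. indicator (cbox a b) x * ?f x \<partial>lborel) = ?L"
    by (simp add: mvn_box_eq box_integral_UNIV[OF cont] set_lebesgue_integral_def)
  finally have L: "emeasure (mvn 0 R) (cbox a b) = ennreal ?L" .
  have "truncated_mvn 0 R a b = density (density lborel (\<lambda>x. ennreal (?f x)))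
      (\<lambda>x. indicator (cbox a b) x / ennreal ?L)"
    unfolding truncated_mvn_def uniform_measure_def S L by (simp add: mvn_def)
  also have "\<dots> = density lborel (\<lambda>x. ennreal (?f x) * (indicator (cbox a b) x / ennreal ?L))"
    by (rule density_density_eq) measurable
  also have "\<dots> = density lborel (\<lambda>x. ennreal (indicator (cbox a b) x * ?f x / ?L))"
    using box_probability_pos nonneg
    by (intro arg_cong[of _ _ "density lborel"] ext)
      (auto simp: indicator_def divide_ennreal ennreal_mult[symmetric] ennreal_1[symmetric]
        simp del: ennreal_1)
  finally show ?thesis .
qed

lemma truncated_mvn_integral:
  fixes g :: "real ^ 'n \<Rightarrow> real"
  assumes g: "continuous_on UNIV g"
  shows "(\<integral>x. g x \<partial>truncated_mvn 0 R a b) =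
    box_integral UNIV a b (\<lambda>x. g x * mvn_density UNIV 0 R x) / mvn_box UNIV a b 0 R"
proof -
  let ?f = "mvn_density UNIV 0 R" and ?L = "mvn_box UNIV a b 0 R"
  have cont: "continuous_on UNIV ?f" by (intro continuous_intros)
  have [measurable]: "?f \<in> borel_measurable borel" "g \<in> borel_measurable borel"
    using borel_measurable_continuous_onI cont g by blast+
  have nonneg: "0 \<le> ?f x" for x
    using density_pos[of x] by simp
  have "(\<integral>x. g x \<partial>truncated_mvn 0 R a b) = (\<integral>x. (indicator (cbox a b) x * ?f x / ?L) *\<^sub>R g x \<partial>lborel)"
    unfolding truncated_mvn_eq_density
    using nonneg box_probability_pos by (intro integral_density) auto
  also have "\<dots> = (\<integral>x. indicator (cbox a b) x *\<^sub>R (g x * ?f x) / ?L \<partial>lborel)"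
    by (intro Bochner_Integration.integral_cong) auto
  also have "\<dots> = (LINT x : cbox a b | lborel. g x * ?f x) / ?L"
    unfolding set_lebesgue_integral_def by simp
  also have "(LINT x : cbox a b | lborel. g x * ?f x) = box_integral UNIV a b (\<lambda>x. g x * ?f x)"
    by (intro box_integral_UNIV[symmetric] continuous_intros g)
  finally show ?thesis .
qed

lemma AE_truncated_mvn: "AE x in truncated_mvn 0 R a b. x \<in> cbox a b"
proof -
  have [measurable]: "mvn_density UNIV 0 R \<in> borel_measurable borel"
    by (intro borel_measurable_continuous_onI continuous_intros)
  show ?thesis
    unfolding truncated_mvn_eq_density
    by (subst AE_density) (auto simp: indicator_def)
qed

end

section \<open>Moments of the truncated normal law\<close>

theorem theorem3:
  fixes R :: "real ^ 'n::finite ^ 'n"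
    and a b q :: "real ^ 'n"
    and H :: "real ^ 'n ^ 'n"
    and L :: real
    and M :: "'w measure"
    and X :: "'w \<Rightarrow> real ^ 'n"
  assumes R: "correlation_matrix R" "invertible R"
    and box: "\<And>i. a $ i < b $ i"
    and M: "prob_space M"
    and X: "X \<in> borel_measurable M" "distr M borel X = truncated_mvn 0 R a b"
    and L: "L = mvn_box UNIV a b 0 R"
    and q: "q = q_vec R a b"
    and H: "H = H_mat R a b"
  shows "(integrable M X \<and> GDERIV (mgf M X) 0 :> mean_vec M X
            \<and> mean_vec M X = (1 / L) *\<^sub>R (R *v q))
       \<and> (integrable M (\<lambda>\<omega>. outer (X \<omega>) (X \<omega>)) \<and> has_hessian (mgf M X) (second_moment M X) 0
            \<and> second_moment M X = R + (1 / L) *\<^sub>R (R ** H ** R))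
       \<and> cov_mat M X = R + (1 / L\<^sup>2) *\<^sub>R (R ** (L *\<^sub>R H - outer q q) ** R)
       \<and> transpose H = H"
proof -
  interpret prob_space M by (rule M)
  interpret correlation_box R a b
    using R box psd_invertible_pos_def[of R]
    by unfold_locales (auto simp: correlation_matrix_def)
  have L_pos: "0 < L" unfolding L by (rule box_probability_pos)
  \<comment> \<open>the law of \<open>X\<close> lives on a compact box, so all moments exist\<close>
  obtain B where B: "0 \<le> B" "\<And>x. x \<in> cbox a b \<Longrightarrow> norm x \<le> B"
  proof -
    obtain B where B: "\<And>x. x \<in> cbox a b \<Longrightarrow> norm x \<le> B"
      using bounded_cbox[of a b] by (auto simp: bounded_iff)
    then have "0 \<le> max 0 B" "\<And>x. x \<in> cbox a b \<Longrightarrow> norm x \<le> max 0 B"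
      by (auto simp: le_max_iff_disj)
    then show thesis by (rule that)
  qed
  have "AE x in distr M borel X. x \<in> cbox a b"
    unfolding X(2) by (rule AE_truncated_mvn)
  then have "AE \<omega> in M. X \<omega> \<in> cbox a b"
    by (subst (asm) AE_distr_iff) (use X(1) in auto)
  then have bounded: "AE \<omega> in M. norm (X \<omega>) \<le> B"
    by (rule eventually_mono) (rule B(2))
  have expect: "(\<integral>\<omega>. g (X \<omega>) \<partial>M) = box_integral UNIV a b (\<lambda>x. g x * mvn_density UNIV 0 R x) / L"
    if g: "continuous_on UNIV g" for g :: "real ^ 'n \<Rightarrow> real"
  proof -
    have "(\<integral>\<omega>. g (X \<omega>) \<partial>M) = (\<integral>x. g x \<partial>distr M borel X)"
      by (rule integral_distr[symmetric]) (use X(1) borel_measurable_continuous_onI[OF g] in auto)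
    then show ?thesis
      unfolding X(2) truncated_mvn_integral[OF g] L .
  qed
  have int: "integrable M (\<lambda>\<omega>. g (X \<omega>))"
    if "continuous_on UNIV g" for g :: "real ^ 'n \<Rightarrow> 'c::{banach, second_countable_topology}"
    by (rule integrable_continuous_bounded[OF X(1) bounded that])
  have int_X: "integrable M X"
    using int[of "\<lambda>x. x"] by (simp add: continuous_on_id)
  have int_nth: "integrable M (\<lambda>\<omega>. X \<omega> $ i)" for i
    by (rule int) (intro continuous_intros)
  have int_nth2: "integrable M (\<lambda>\<omega>. X \<omega> $ i * X \<omega> $ j)" for i j
    by (rule int) (intro continuous_intros)
  have int_outer: "integrable M (\<lambda>\<omega>. outer (X \<omega>) (X \<omega>))"
    by (rule int[of "\<lambda>x. outer x x"]) (intro continuous_intros)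
  have nth: "(\<integral>\<omega>. f \<omega> \<partial>M) $ i $ j = (\<integral>\<omega>. f \<omega> $ i $ j \<partial>M)" if "integrable M f"
    for f :: "'w \<Rightarrow> real ^ 'n ^ 'n" and i j
    using integral_bounded_linear[OF bounded_linear_compose[OF bounded_linear_vec_nth
          bounded_linear_vec_nth] that, of i j] by simp
  have E1: "mean_vec M X $ i = (\<integral>\<omega>. X \<omega> $ i \<partial>M)" for i
    unfolding mean_vec_def
    using integral_bounded_linear[OF bounded_linear_vec_nth int_X, of i] by simp
  have E1': "(\<integral>\<omega>. X \<omega> $ i \<partial>M) = (R *v q) $ i / L" for i
    by (subst expect) (auto intro!: continuous_intros simp: box_integral_first_moment q)
  have mean: "mean_vec M X = (1 / L) *\<^sub>R (R *v q)"
    by (simp add: vec_eq_iff E1 E1')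
  have E2: "(\<integral>\<omega>. X \<omega> $ i * X \<omega> $ j \<partial>M) = R $ i $ j + (R ** H ** R) $ i $ j / L" for i j
  proof -
    have "(\<integral>\<omega>. X \<omega> $ i * X \<omega> $ j \<partial>M) = (R $ i $ j * L + (R ** H ** R) $ i $ j) / L"
      by (subst expect[of "\<lambda>x. x $ i * x $ j"])
        (auto intro!: continuous_intros simp: box_integral_second_moment L H)
    with L_pos show ?thesis by (simp add: field_simps)
  qed
  have second: "second_moment M X = R + (1 / L) *\<^sub>R (R ** H ** R)"
    by (simp add: vec_eq_iff second_moment_def nth[OF int_outer] E2)
  have cov: "cov_mat M X = R + (1 / L\<^sup>2) *\<^sub>R (R ** (L *\<^sub>R H - outer q q) ** R)"
  proof -
    let ?m = "mean_vec M X"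
    have "integrable M (\<lambda>\<omega>. outer (X \<omega> - ?m) (X \<omega> - ?m))"
      by (rule int[of "\<lambda>x. outer (x - ?m) (x - ?m)"]) (intro continuous_intros)
    then have "cov_mat M X $ i $ j = (\<integral>\<omega>. (X \<omega> $ i - ?m $ i) * (X \<omega> $ j - ?m $ j) \<partial>M)" for i j
      by (simp add: cov_mat_def nth)
    also have "(\<integral>\<omega>. (X \<omega> $ i - ?m $ i) * (X \<omega> $ j - ?m $ j) \<partial>M) =
        (\<integral>\<omega>. X \<omega> $ i * X \<omega> $ j - X \<omega> $ i * ?m $ j - (?m $ i * X \<omega> $ j - ?m $ i * ?m $ j) \<partial>M)" for i j
      by (intro Bochner_Integration.integral_cong refl) (simp add: algebra_simps)
    also have "\<dots> i j = (\<integral>\<omega>. X \<omega> $ i * X \<omega> $ j \<partial>M) - ?m $ i * ?m $ j" for i j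
      using int_nth int_nth2 by (simp add: prob_space flip: E1)
    finally have cov_nth: "cov_mat M X $ i $ j = (\<integral>\<omega>. X \<omega> $ i * X \<omega> $ j \<partial>M) - ?m $ i * ?m $ j" for i j .
    have Rqq: "(R ** outer q q ** R) $ i $ j = (R *v q) $ i * (R *v q) $ j" for i j
    proof -
      have "(R ** outer q q ** R) $ i $ j = (\<Sum>l\<in>UNIV. (\<Sum>k\<in>UNIV. R $ i $ k * (q $ k * q $ l)) * R $ j $ l)"
        by (simp add: matrix_matrix_mult_def sym_nth[of _ j])
      also have "\<dots> = (\<Sum>l\<in>UNIV. (\<Sum>k\<in>UNIV. R $ i $ k * q $ k) * (R $ j $ l * q $ l))"
        unfolding sum_distrib_right by (intro sum.cong refl) (simp only: mult_ac)
      also have "\<dots> = (R *v q) $ i * (R *v q) $ j"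
        by (simp add: matrix_vector_mult_def sum_distrib_left)
      finally show ?thesis .
    qed
    have "R ** (L *\<^sub>R H - outer q q) ** R = L *\<^sub>R (R ** H ** R) - R ** outer q q ** R"
      by (simp add: matrix_diff_ldistrib matrix_diff_rdistrib matrix_scalar_ac scalar_matrix_assoc)
    then have "(R ** (L *\<^sub>R H - outer q q) ** R) $ i $ j =
        L * (R ** H ** R) $ i $ j - (R *v q) $ i * (R *v q) $ j" for i j
      by (simp add: Rqq)
    then show ?thesis
      using L_pos
      by (simp add: vec_eq_iff cov_nth E2 mean diff_divide_distrib power2_eq_square)
  qed
  show ?thesis
    using int_X int_outer mgf_derivatives[OF X(1) B(1) bounded] mean second cov
      H_mat_symmetric H by blast
qed

end
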